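(* Let $n\ge2$ and write $n=2p$ if $n$ is even and $n=2p+1$ if $n$ is odd. There is a bijection between the set $\widehat{\mathscr D}^{\mathrm i}(n+2)$ of i-isomorphism classes of diagonalizable singular quadratic Lie algebra structures on $\mathbb C^{n+2}$ and $\Lambda_p/H_p$. Moreover, if $n=2p+1$, then the set $\widehat{\mathscr D}_{\mathrm{red}}(n+2)$ of isomorphism classes of reduced diagonalizable singular structures on $\mathbb C^{n+2}$ is empty, and if $n=2p$, then $\widehat{\mathscr D}_{\mathrm{red}}(2p+2)$ is in bijection with $\Lambda_p^+/H_p$.
   Context: All vector spaces are finite-dimensional over $\mathbb C$. $\Lambda_p=\{(\lambda_1,\dots,\lambda_p)\in\mathbb C^p\mid\lambda_i\ne0\text{ for some }i\}$ and $\Lambda_p^+=\{(\lambda_1,\dots,\lambda_p)\in\mathbb C^p\mid\lambda_i\neq0\ \forall i\}$. $H_p$ is the group of transformations of $\mathbb C^p$ generated by all permutations of the coordinates, all sign changes of coordinates (any number of signs), and all multiplications by non-zero scalars $(\lambda_1,\dots,\lambda_p)\mapsto\lambda(\lambda_1,\dots,\lambda_p)$, $\lambda\in\mathbb C\setminus\{0\}$. A quadratic Lie algebra $(\mathfrak g,B)$ is a Lie algebra with a non-degenerate symmetric invariant bilinear form. An i-isomorphism is a Lie algebra isomorphism that is an isometry. Let $I(X,Y,Z)=B([X,Y],Z)$ and $\mathrm{dup}(\mathfrak g)=\dim\{\alpha\in\mathfrak g^*\mid\alpha\wedge I=0\}$; a non-Abelian quadratic Lie algebra is singular if $\mathrm{dup}(\mathfrak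 g)\ge1$. A quadratic Lie algebra $\mathfrak g\ne\{0\}$ is reduced if its center is totally isotropic. A quadratic Lie algebra structure on $\mathbb C^{n+2}$ is a Lie bracket for which the canonical non-degenerate symmetric bilinear form of $\mathbb C^{n+2}$ is invariant. Every solvable singular quadratic Lie algebra is a double extension: it has an orthogonal decomposition $\mathfrak g=(\mathbb CX_0\oplus\mathbb CY_0)\oplus\mathfrak q$ with $B(X_0,X_0)=B(Y_0,Y_0)=0$, $B(X_0,Y_0)=1$, and bracket $[X+\lambda X_0+\mu Y_0,\,Y+\lambda'X_0+\mu'Y_0]=\mu\overline C(Y)-\mu'\overline C(X)+B(\overline C(X),Y)X_0$ ($X,Y\in\mathfrak q$), where $\overline C=\mathrm{ad}(Y_0)|_{\mathfrak q}$ is skew-symmetric. A solvable singular quadratic Lie algebra is called diagonalizable if $\overline C$ is diagonalizable (this does not depend on the decomposition). *)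

theory Defs
  imports
    "HOL-Algebra.Bij"
    "HOL-Algebra.Generated_Groups"
    "HOL-Library.Function_Algebras"
    "HOL-Analysis.Analysis"
begin

section \<open>Quadratic Lie algebras\<close>

text \<open>
  The underlying vector space is always \<open>complex ^ 'm\<close>, with the complex scalar
  multiplication \<open>(*s)\<close>; a Lie algebra structure on it is given by its bracket.
\<close>

definition clinear :: "(complex ^ 'm \<Rightarrow> complex ^ 'n) \<Rightarrow> bool" where
  "clinear f \<longleftrightarrow> Vector_Spaces.linear (*s) (*s) f"

definition lin_functional :: "(complex ^ 'm \<Rightarrow> complex) \<Rightarrow> bool" where
  "lin_functional \<alpha> \<longleftrightarrow> Vector_Spaces.linear (*s) (*) \<alpha>"

definition lie_bracket :: "(complex ^ 'm \<Rightarrow> complex ^ 'm \<Rightarrow> complex ^ 'm) \<Rightarrow> bool" where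
  "lie_bracket br \<longleftrightarrow>
     (\<forall>x. clinear (br x)) \<and> (\<forall>y. clinear (\<lambda>x. br x y)) \<and>
     (\<forall>x. br x x = 0) \<and>
     (\<forall>x y z. br x (br y z) + br y (br z x) + br z (br x y) = 0)"

definition nondeg_sym_bilinear_form :: "(complex ^ 'm \<Rightarrow> complex ^ 'm \<Rightarrow> complex) \<Rightarrow> bool" where
  "nondeg_sym_bilinear_form B \<longleftrightarrow>
     (\<forall>x. lin_functional (B x)) \<and> (\<forall>y. lin_functional (\<lambda>x. B x y)) \<and>
     (\<forall>x y. B x y = B y x) \<and>
     (\<forall>x. (\<forall>y. B x y = 0) \<longrightarrow> x = 0)"

definition quadratic_lie_algebra ::
    "(complex ^ 'm \<Rightarrow> complex ^ 'm \<Rightarrow> complex ^ 'm) \<Rightarrow> (complex ^ 'm \<Rightarrow> complex ^ 'm \<Rightarrow> complex) \<Rightarrow> bool" where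
  "quadratic_lie_algebra br B \<longleftrightarrow>
     lie_bracket br \<and> nondeg_sym_bilinear_form B \<and>
     (\<forall>x y z. B (br x y) z = B x (br y z))"

definition lie_isomorphism ::
    "(complex ^ 'm \<Rightarrow> complex ^ 'm \<Rightarrow> complex ^ 'm) \<Rightarrow> (complex ^ 'm \<Rightarrow> complex ^ 'm \<Rightarrow> complex ^ 'm) \<Rightarrow>
     (complex ^ 'm \<Rightarrow> complex ^ 'm) \<Rightarrow> bool" where
  "lie_isomorphism br br' \<phi> \<longleftrightarrow>
     clinear \<phi> \<and> bij \<phi> \<and> (\<forall>x y. \<phi> (br x y) = br' (\<phi> x) (\<phi> y))"

definition i_isomorphism ::
    "(complex ^ 'm \<Rightarrow> complex ^ 'm \<Rightarrow> complex ^ 'm) \<Rightarrow> (complex ^ 'm \<Rightarrow> complex ^ 'm \<Rightarrow> complex) \<Rightarrow>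
     (complex ^ 'm \<Rightarrow> complex ^ 'm \<Rightarrow> complex ^ 'm) \<Rightarrow> (complex ^ 'm \<Rightarrow> complex ^ 'm \<Rightarrow> complex) \<Rightarrow>
     (complex ^ 'm \<Rightarrow> complex ^ 'm) \<Rightarrow> bool" where
  "i_isomorphism br B br' B' \<phi> \<longleftrightarrow>
     lie_isomorphism br br' \<phi> \<and> (\<forall>x y. B' (\<phi> x) (\<phi> y) = B x y)"

definition abelian_bracket :: "(complex ^ 'm \<Rightarrow> complex ^ 'm \<Rightarrow> complex ^ 'm) \<Rightarrow> bool" where
  "abelian_bracket br \<longleftrightarrow> (\<forall>x y. br x y = 0)"

definition lie_center :: "(complex ^ 'm \<Rightarrow> complex ^ 'm \<Rightarrow> complex ^ 'm) \<Rightarrow> (complex ^ 'm) set" where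
  "lie_center br = {x. \<forall>y. br x y = 0}"

primrec derived_series ::
    "(complex ^ 'm \<Rightarrow> complex ^ 'm \<Rightarrow> complex ^ 'm) \<Rightarrow> nat \<Rightarrow> (complex ^ 'm) set" where
  "derived_series br 0 = UNIV"
| "derived_series br (Suc k) =
     vec.span {br x y | x y. x \<in> derived_series br k \<and> y \<in> derived_series br k}"

definition lie_solvable :: "(complex ^ 'm \<Rightarrow> complex ^ 'm \<Rightarrow> complex ^ 'm) \<Rightarrow> bool" where
  "lie_solvable br \<longleftrightarrow> (\<exists>k. derived_series br k = {0})"


section \<open>The dup number, singular and reduced algebras\<close>

definition canonical_3form ::
    "(complex ^ 'm \<Rightarrow> complex ^ 'm \<Rightarrow> complex ^ 'm) \<Rightarrow> (complex ^ 'm \<Rightarrow> complex ^ 'm \<Rightarrow> complex) \<Rightarrow>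
     complex ^ 'm \<Rightarrow> complex ^ 'm \<Rightarrow> complex ^ 'm \<Rightarrow> complex" where
  "canonical_3form br B x y z = B (br x y) z"

text \<open>
  The exterior product of a 1-form with an alternating 3-form, as the signed sum over
  the (1,3)-shuffles.
\<close>

definition wedge_1_3 ::
    "('v \<Rightarrow> complex) \<Rightarrow> ('v \<Rightarrow> 'v \<Rightarrow> 'v \<Rightarrow> complex) \<Rightarrow> 'v \<Rightarrow> 'v \<Rightarrow> 'v \<Rightarrow> 'v \<Rightarrow> complex" where
  "wedge_1_3 \<alpha> I x y z w =
     \<alpha> x * I y z w - \<alpha> y * I x z w + \<alpha> z * I x y w - \<alpha> w * I x y z"

text \<open>Dimensions of spaces of functionals are taken in the space of all functions to \<open>complex\<close>.\<close>

lemma vector_space_pointwise: "vector_space (\<lambda>(c::complex) (\<alpha>::'v \<Rightarrow> complex) x. c * \<alpha> x)"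
  by unfold_locales (auto simp: fun_eq_iff algebra_simps)

definition dup_space ::
    "(complex ^ 'm \<Rightarrow> complex ^ 'm \<Rightarrow> complex ^ 'm) \<Rightarrow> (complex ^ 'm \<Rightarrow> complex ^ 'm \<Rightarrow> complex) \<Rightarrow>
     (complex ^ 'm \<Rightarrow> complex) set" where
  "dup_space br B =
     {\<alpha>. lin_functional \<alpha> \<and> (\<forall>x y z w. wedge_1_3 \<alpha> (canonical_3form br B) x y z w = 0)}"

definition dup ::
    "(complex ^ 'm \<Rightarrow> complex ^ 'm \<Rightarrow> complex ^ 'm) \<Rightarrow> (complex ^ 'm \<Rightarrow> complex ^ 'm \<Rightarrow> complex) \<Rightarrow> nat" where
  "dup br B = vector_space.dim (\<lambda>c \<alpha> x. c * \<alpha> x) (dup_space br B)"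

definition singular_quadratic ::
    "(complex ^ 'm \<Rightarrow> complex ^ 'm \<Rightarrow> complex ^ 'm) \<Rightarrow> (complex ^ 'm \<Rightarrow> complex ^ 'm \<Rightarrow> complex) \<Rightarrow> bool" where
  "singular_quadratic br B \<longleftrightarrow>
     quadratic_lie_algebra br B \<and> \<not> abelian_bracket br \<and> dup br B \<ge> 1"

definition reduced_quadratic ::
    "(complex ^ 'm \<Rightarrow> complex ^ 'm \<Rightarrow> complex ^ 'm) \<Rightarrow> (complex ^ 'm \<Rightarrow> complex ^ 'm \<Rightarrow> complex) \<Rightarrow> bool" where
  "reduced_quadratic br B \<longleftrightarrow>
     quadratic_lie_algebra br B \<and> (UNIV :: (complex ^ 'm) set) \<noteq> {0} \<and>
     (\<forall>x \<in> lie_center br. \<forall>y \<in> lie_center br. B x y = 0)"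


section \<open>Double extensions and diagonalizable algebras\<close>

text \<open>
  \<open>double_ext_decomp br B X0 Y0 q C\<close>: the space is the orthogonal direct sum of the hyperbolic
  plane spanned by \<open>X0\<close>, \<open>Y0\<close> and of \<open>q\<close>, and the bracket is that of the double extension of
  \<open>q\<close> by \<open>C\<close>. Only the values of \<open>C\<close> on \<open>q\<close> matter.
\<close>

definition double_ext_decomp ::
    "(complex ^ 'm \<Rightarrow> complex ^ 'm \<Rightarrow> complex ^ 'm) \<Rightarrow> (complex ^ 'm \<Rightarrow> complex ^ 'm \<Rightarrow> complex) \<Rightarrow>
     complex ^ 'm \<Rightarrow> complex ^ 'm \<Rightarrow> (complex ^ 'm) set \<Rightarrow> (complex ^ 'm \<Rightarrow> complex ^ 'm) \<Rightarrow> bool" where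
  "double_ext_decomp br B X0 Y0 q C \<longleftrightarrow>
     B X0 X0 = 0 \<and> B Y0 Y0 = 0 \<and> B X0 Y0 = 1 \<and>
     vec.subspace q \<and> (\<forall>X \<in> q. B X0 X = 0 \<and> B Y0 X = 0) \<and>
     vec.span {X0, Y0} \<inter> q = {0} \<and>
     (\<forall>v. \<exists>X \<in> q. \<exists>l m. v = X + l *s X0 + m *s Y0) \<and>
     (\<forall>X \<in> q. C X = br Y0 X \<and> C X \<in> q) \<and>
     (\<forall>X \<in> q. \<forall>Y \<in> q. B (C X) Y = - B X (C Y)) \<and>
     (\<forall>X \<in> q. \<forall>Y \<in> q. \<forall>l m l' m'.
        br (X + l *s X0 + m *s Y0) (Y + l' *s X0 + m' *s Y0) =
        m *s C Y - m' *s C X + B (C X) Y *s X0)"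

definition diagonalizable_on :: "(complex ^ 'm) set \<Rightarrow> (complex ^ 'm \<Rightarrow> complex ^ 'm) \<Rightarrow> bool" where
  "diagonalizable_on q C \<longleftrightarrow>
     (\<exists>b. b \<subseteq> q \<and> vec.independent b \<and> vec.span b = q \<and> (\<forall>v \<in> b. \<exists>c. C v = c *s v))"

definition diagonalizable_singular ::
    "(complex ^ 'm \<Rightarrow> complex ^ 'm \<Rightarrow> complex ^ 'm) \<Rightarrow> (complex ^ 'm \<Rightarrow> complex ^ 'm \<Rightarrow> complex) \<Rightarrow> bool" where
  "diagonalizable_singular br B \<longleftrightarrow>
     singular_quadratic br B \<and> lie_solvable br \<and>
     (\<exists>X0 Y0 q C. double_ext_decomp br B X0 Y0 q C \<and> diagonalizable_on q C)"


section \<open>Structures on the canonical quadratic space, up to isomorphism\<close>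

text \<open>
  This is the bilinear (not the Hermitian) form; the real inner product \<open>(\<bullet>)\<close> on
  \<open>complex ^ 'm\<close> is a different map.
\<close>

definition canonical_form :: "complex ^ 'm \<Rightarrow> complex ^ 'm \<Rightarrow> complex" where
  "canonical_form x y = (\<Sum>i\<in>UNIV. x $ i * y $ i)"

definition diag_structures :: "(complex ^ 'm \<Rightarrow> complex ^ 'm \<Rightarrow> complex ^ 'm) set" where
  "diag_structures = {br. diagonalizable_singular br canonical_form}"

definition red_diag_structures :: "(complex ^ 'm \<Rightarrow> complex ^ 'm \<Rightarrow> complex ^ 'm) set" where
  "red_diag_structures = {br \<in> diag_structures. reduced_quadratic br canonical_form}"

definition diag_i_classes :: "(complex ^ 'm \<Rightarrow> complex ^ 'm \<Rightarrow> complex ^ 'm) set set" where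
  "diag_i_classes = diag_structures //
     {(br, br'). br \<in> diag_structures \<and> br' \<in> diag_structures \<and>
        (\<exists>\<phi>. i_isomorphism br canonical_form br' canonical_form \<phi>)}"

definition red_diag_classes :: "(complex ^ 'm \<Rightarrow> complex ^ 'm \<Rightarrow> complex ^ 'm) set set" where
  "red_diag_classes = red_diag_structures //
     {(br, br'). br \<in> red_diag_structures \<and> br' \<in> red_diag_structures \<and>
        (\<exists>\<phi>. lie_isomorphism br br' \<phi>)}"


section \<open>The parameter spaces\<close>

definition Lambda :: "(complex ^ 'p) set" where
  "Lambda = {v. \<exists>i. v $ i \<noteq> 0}"

definition Lambda_plus :: "(complex ^ 'p) set" where
  "Lambda_plus = {v. \<forall>i. v $ i \<noteq> 0}"

definition H_generators :: "(complex ^ 'p \<Rightarrow> complex ^ 'p) set" where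
  "H_generators =
     {(\<lambda>v. \<chi> i. v $ \<pi> i) | \<pi>. bij \<pi>} \<union>
     {(\<lambda>v. \<chi> i. s i * v $ i) | s. \<forall>i. s i = 1 \<or> s i = - 1} \<union>
     {(\<lambda>v. c *s v) | c. c \<noteq> 0}"

definition H_group :: "(complex ^ 'p \<Rightarrow> complex ^ 'p) set" where
  "H_group = generate (BijGroup UNIV) H_generators"

definition H_orbits :: "(complex ^ 'p) set \<Rightarrow> (complex ^ 'p) set set" where
  "H_orbits S = S // {(v, w). v \<in> S \<and> w \<in> S \<and> (\<exists>h \<in> H_group. w = h v)}"

end

theory Submission
  imports Defs
begin

text \<open>
Every structure in question is a double extension of an abelian quadratic space by a
diagonalizable skew map $C$, and the whole classification rests on putting the isotropic vector
\<open>X0\<close> and the map $C$ simultaneously into a normal form by an isometry.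

Extending $C$ by $0$ to the hyperbolic plane turns the bracket of the double extension into the
single formula \<open>dext C X0\<close>, valid for all vectors, in which \<open>q\<close> and \<open>Y0\<close> no longer occur.
An isometry that intertwines two such maps and takes one isotropic vector to the other is then an
i-isomorphism (\<open>dext_i_isomorphism\<close>). For a parameter \<open>v\<close> the standard structure \<open>std v\<close> groups
the coordinates into pairs: one pair spans the hyperbolic plane, and on the pair with index \<open>j\<close>
the map is a rotation with eigenvalues \<open>v $ j\<close> and \<open>- v $ j\<close>. In odd dimension one coordinate is
left over, and the map kills it.

Every diagonalizable structure is standard: $C$ being skew, an eigenvector for $a \neq 0$ is
isotropic and pairs non-trivially with some eigenvector for $-a$, so the two span a hyperbolic
plane, and the orthogonal complement is again stable. Collecting such planes one after the other
gives an orthonormal basis adapted to $C$ (\<open>exists_rotation_pair\<close>, \<open>exists_partial_frame\<close>,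
\<open>diagonalizable_i_isomorphic_std\<close>).

The group acts by isomorphisms: permutations and sign changes of the parameter come from signed
permutations of the coordinates, and the scaling of the parameter by \<open>c\<close> is absorbed by the
hyperbolic rotation taking \<open>X0\<close> to \<open>c *s X0\<close> (\<open>H_group_i_isomorphic\<close>).

Conversely the orbit is an invariant of the bare Lie algebra. For $c \neq 0$ the
$c$-eigenspace of $\mathrm{ad}(x)$ has the dimension of the $c$-eigenspace of $mC$, where $m$ is the
coefficient of \<open>Y0\<close> in $x$, and that is the number of $j$ with $(m v_j)^2 = c^2$
(\<open>dim_adjoint_eigenspace\<close>). An isomorphism preserves these dimensions, so the squares
$v_j^2$ are determined up to order and a common non-zero factor $m^2$, which is the
equivalence under the group (\<open>lie_isomorphic_std_signed_permutation\<close>). Hence isomorphism and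
i-isomorphism agree on standard structures, and the same bijection serves both parts.

Finally, the centre of \<open>std v\<close> contains every coordinate axis outside the hyperbolic plane that is
killed by the map, and such an axis is not isotropic; if there is none, the centre is the line of
\<open>X0\<close>. So \<open>std v\<close> is reduced exactly if no coordinate is left over and no \<open>v $ j\<close> vanishes.
\<close>

section \<open>The canonical bilinear form\<close>

abbreviation cf :: "complex ^ 'm \<Rightarrow> complex ^ 'm \<Rightarrow> complex" where
  "cf \<equiv> canonical_form"

lemma clinear_iff:
  "clinear f \<longleftrightarrow> (\<forall>x y. f (x + y) = f x + f y) \<and> (\<forall>c x. f (c *s x) = c *s f x)"
  by (simp add: clinear_def Vector_Spaces.linear_iff vec.vector_space_axioms)

lemma lin_functional_iff:
  "lin_functional f \<longleftrightarrow> (\<forall>x y. f (x + y) = f x + f y) \<and> (\<forall>c x. f (c *s x) = c * f x)"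
  unfolding lin_functional_def Vector_Spaces.linear_iff
  by (auto simp: vec.vector_space_axioms vector_space_over_itself.vector_space_axioms)

lemma clinear_simps:
  assumes "clinear f"
  shows "f (x + y) = f x + f y" "f (c *s x) = c *s f x" "f 0 = 0" "f (x - y) = f x - f y"
    "f (- x) = - f x"
  using assms Vector_Spaces.linear.axioms(3)[of "(*s)" "(*s)" f]
  unfolding clinear_def
  by (auto dest: module_hom.add module_hom.scale module_hom.zero module_hom.diff module_hom.neg)

lemma clinear_sum: "clinear f \<Longrightarrow> f (sum g A) = (\<Sum>a\<in>A. f (g a))"
  using Vector_Spaces.linear.axioms(3)[of "(*s)" "(*s)" f]
  unfolding clinear_def by (auto dest: module_hom.sum)

lemma clinear_comp: "clinear f \<Longrightarrow> clinear g \<Longrightarrow> clinear (\<lambda>x. f (g x))"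
  by (simp add: clinear_iff)

lemma cf_add_left: "cf (x + y) z = cf x z + cf y z"
  by (simp add: canonical_form_def algebra_simps sum.distrib)

lemma cf_add_right: "cf z (x + y) = cf z x + cf z y"
  by (simp add: canonical_form_def algebra_simps sum.distrib)

lemma cf_diff_left: "cf (x - y) z = cf x z - cf y z"
  by (simp add: canonical_form_def algebra_simps sum_subtractf)

lemma cf_diff_right: "cf z (x - y) = cf z x - cf z y"
  by (simp add: canonical_form_def algebra_simps sum_subtractf)

lemma cf_scale_left: "cf (c *s x) z = c * cf x z"
  by (simp add: canonical_form_def sum_distrib_left algebra_simps)

lemma cf_scale_right: "cf z (c *s x) = c * cf z x"
  by (simp add: canonical_form_def sum_distrib_left algebra_simps)

lemma cf_zero_left: "cf 0 z = 0"
  by (simp add: canonical_form_def)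

lemma cf_zero_right: "cf z 0 = 0"
  by (simp add: canonical_form_def)

lemma cf_commute: "cf x y = cf y x"
  by (simp add: canonical_form_def mult.commute)

lemmas cf_simps = cf_add_left cf_add_right cf_diff_left cf_diff_right cf_scale_left
  cf_scale_right cf_zero_left cf_zero_right

lemma cf_sum_left: "cf (sum f A) z = (\<Sum>a\<in>A. cf (f a) z)"
  by (induction A rule: infinite_finite_induct) (auto simp: cf_simps)

lemma cf_sum_right: "cf z (sum f A) = (\<Sum>a\<in>A. cf z (f a))"
  by (induction A rule: infinite_finite_induct) (auto simp: cf_simps)

lemma cf_axis_right: "cf x (axis k 1) = x $ k"
  by (simp add: canonical_form_def axis_def if_distrib cong: if_cong)

lemma cf_axis_left: "cf (axis k 1) x = x $ k"
  by (simp add: cf_axis_right cf_commute)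

lemma cf_axis_axis: "cf (axis k 1) (axis l 1) = (if k = l then 1 else 0)"
  by (subst cf_axis_right) (simp add: axis_def)

lemma cf_nondegenerate:
  assumes "\<And>y. cf x y = 0"
  shows "x = 0"
  using assms[of "axis _ 1"] by (simp add: vec_eq_iff cf_axis_right)

lemma nondeg_sym_bilinear_form_cf: "nondeg_sym_bilinear_form cf"
  unfolding nondeg_sym_bilinear_form_def lin_functional_iff
  by (auto simp: cf_simps cf_commute intro: cf_nondegenerate)

section \<open>Double extensions written without a decomposition\<close>

definition skew :: "(complex ^ 'm \<Rightarrow> complex ^ 'm) \<Rightarrow> bool" where
  "skew C \<longleftrightarrow> clinear C \<and> (\<forall>x y. cf (C x) y = - cf x (C y))"

text \<open>
For the extension of $C$ by zero to the hyperbolic plane of \<open>X\<close> and \<open>Y\<close>, this is the bracket of the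
double extension: the coefficient of \<open>Y\<close> in \<open>x\<close> is \<open>cf X x\<close>, because \<open>cf X X = 0\<close> and
\<open>cf X Y = 1\<close>.
\<close>

definition dext ::
  "(complex ^ 'm \<Rightarrow> complex ^ 'm) \<Rightarrow> complex ^ 'm \<Rightarrow> complex ^ 'm \<Rightarrow> complex ^ 'm \<Rightarrow> complex ^ 'm"
  where "dext C X x y = cf X x *s C y - cf X y *s C x + cf (C x) y *s X"

lemma skew_clinear: "skew C \<Longrightarrow> clinear C"
  by (simp add: skew_def)

lemma skew_cf: "skew C \<Longrightarrow> cf (C x) y = - cf x (C y)"
  by (simp add: skew_def)

lemma skew_cf_self: "skew C \<Longrightarrow> cf (C x) x = 0"
  using skew_cf[of C x x] by (simp add: cf_commute eq_neg_iff_add_eq_0 flip: mult_2)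

lemma skew_cf_kernel: "skew C \<Longrightarrow> C X = 0 \<Longrightarrow> cf X (C x) = 0"
  using skew_cf[of C X x] by (simp add: cf_zero_left)

text \<open>
All brackets lie in the orthogonal complement of \<open>X\<close>, so in a nested bracket only one of the two
outer terms containing $C$ survives. The Jacobi sum then cancels in pairs; for the terms
along \<open>X\<close> this is the symmetry of \<open>cf (C x) (C y)\<close>.
\<close>

lemma dext_quadratic:
  assumes C: "skew C" and CX: "C X = 0" and XX: "cf X X = 0"
  shows "quadratic_lie_algebra (dext C X) cf"
proof -
  note lin = clinear_simps[OF skew_clinear[OF C]]
  have X_br: "cf X (dext C X x y) = 0" for x y
    by (simp add: dext_def cf_simps skew_cf_kernel[OF C CX] XX)
  have C_br: "C (dext C X x y) = cf X x *s C (C y) - cf X y *s C (C x)" for x y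
    by (simp add: dext_def lin CX)
  have nested: "dext C X x (dext C X y z) =
      (cf X x * cf X y) *s C (C z) - (cf X x * cf X z) *s C (C y)
      + (cf X y * cf (C x) (C z) - cf X z * cf (C x) (C y)) *s X" for x y z
  proof -
    have "cf (C x) X = 0"
      using skew_cf_kernel[OF C CX] by (simp add: cf_commute)
    then have "cf (C x) (dext C X y z) = cf X y * cf (C x) (C z) - cf X z * cf (C x) (C y)"
      by (simp add: dext_def cf_simps)
    then show ?thesis
      unfolding dext_def[of C X x] X_br C_br
      by (simp add: vec.scale_right_diff_distrib)
  qed
  have "lie_bracket (dext C X)"
    unfolding lie_bracket_def
  proof (intro conjI allI)
    show "clinear (dext C X x)" for x
      unfolding clinear_iff dext_def by (auto simp: lin cf_simps vec_eq_iff algebra_simps)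
    show "clinear (\<lambda>x. dext C X x y)" for y
      unfolding clinear_iff dext_def by (auto simp: lin cf_simps vec_eq_iff algebra_simps)
    show "dext C X x x = 0" for x
      by (simp add: dext_def skew_cf_self[OF C])
    show "dext C X x (dext C X y z) + dext C X y (dext C X z x) + dext C X z (dext C X x y) = 0"
      for x y z
      unfolding nested
      by (simp add: vec_eq_iff algebra_simps cf_commute[of "C y" "C x"]
          cf_commute[of "C z" "C x"] cf_commute[of "C z" "C y"])
  qed
  moreover have "cf (dext C X x y) z = cf x (dext C X y z)" for x y z
    using skew_cf[OF C, of y z] skew_cf[OF C, of x y] skew_cf[OF C, of x z]
    by (simp add: dext_def cf_simps algebra_simps cf_commute)
  ultimately show ?thesis
    by (simp add: quadratic_lie_algebra_def nondeg_sym_bilinear_form_cf)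
qed

definition i_isomorphic ::
  "(complex ^ 'm \<Rightarrow> complex ^ 'm \<Rightarrow> complex ^ 'm) \<Rightarrow>
   (complex ^ 'm \<Rightarrow> complex ^ 'm \<Rightarrow> complex ^ 'm) \<Rightarrow> bool" where
  "i_isomorphic br br' \<longleftrightarrow> (\<exists>\<phi>. i_isomorphism br cf br' cf \<phi>)"

lemma lie_isomorphism_refl: "lie_isomorphism br br id"
  by (simp add: lie_isomorphism_def clinear_iff)

lemma lie_isomorphism_inv:
  assumes "lie_isomorphism br br' \<phi>"
  shows "lie_isomorphism br' br (inv_into UNIV \<phi>)"
proof -
  have bij: "bij \<phi>" and lin: "clinear \<phi>" and hom: "\<And>x y. \<phi> (br x y) = br' (\<phi> x) (\<phi> y)"
    using assms by (auto simp: lie_isomorphism_def)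
  have *: "\<phi> (inv_into UNIV \<phi> y) = y" "inv_into UNIV \<phi> (\<phi> x) = x" for x y
    using bij by (simp_all add: bij_is_surj surj_f_inv_f bij_is_inj)
  let ?\<psi> = "inv_into UNIV \<phi>"
  have "?\<psi> (x + y) = ?\<psi> x + ?\<psi> y" for x y
    using clinear_simps(1)[OF lin, of "?\<psi> x" "?\<psi> y"] *(2)[of "?\<psi> x + ?\<psi> y"]
    by (simp add: *(1))
  moreover have "?\<psi> (c *s x) = c *s ?\<psi> x" for c x
    using clinear_simps(2)[OF lin, of c "?\<psi> x"] *(2)[of "c *s ?\<psi> x"] by (simp add: *(1))
  moreover have "?\<psi> (br' x y) = br (?\<psi> x) (?\<psi> y)" for x y
    using hom[of "?\<psi> x" "?\<psi> y"] *(2)[of "br (?\<psi> x) (?\<psi> y)"] by (simp add: *(1))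
  ultimately show ?thesis
    by (simp add: lie_isomorphism_def clinear_iff bij bij_imp_bij_inv)
qed

lemma lie_isomorphism_comp:
  assumes "lie_isomorphism br br' \<phi>" "lie_isomorphism br' br'' \<psi>"
  shows "lie_isomorphism br br'' (\<psi> \<circ> \<phi>)"
  using assms by (auto simp: lie_isomorphism_def clinear_iff bij_comp)

lemma i_isomorphic_refl: "i_isomorphic br br"
  unfolding i_isomorphic_def i_isomorphism_def
  by (rule exI[of _ id]) (simp add: lie_isomorphism_refl)

lemma i_isomorphic_sym:
  assumes "i_isomorphic br br'"
  shows "i_isomorphic br' br"
proof -
  obtain \<phi> where \<phi>: "lie_isomorphism br br' \<phi>" "\<And>x y. cf (\<phi> x) (\<phi> y) = cf x y"
    using assms by (auto simp: i_isomorphic_def i_isomorphism_def)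
  have "\<phi> (inv_into UNIV \<phi> y) = y" for y
    using \<phi>(1) by (simp add: lie_isomorphism_def bij_is_surj surj_f_inv_f)
  then have "cf (inv_into UNIV \<phi> x) (inv_into UNIV \<phi> y) = cf x y" for x y
    using \<phi>(2)[of "inv_into UNIV \<phi> x" "inv_into UNIV \<phi> y"] by simp
  then show ?thesis
    using lie_isomorphism_inv[OF \<phi>(1)] by (auto simp: i_isomorphic_def i_isomorphism_def)
qed

lemma i_isomorphic_trans:
  assumes "i_isomorphic br br'" "i_isomorphic br' br''"
  shows "i_isomorphic br br''"
proof -
  obtain \<phi> \<psi> where "i_isomorphism br cf br' cf \<phi>" "i_isomorphism br' cf br'' cf \<psi>"
    using assms by (auto simp: i_isomorphic_def)
  then show ?thesis
    unfolding i_isomorphic_def i_isomorphism_def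
    by (intro exI[of _ "\<psi> \<circ> \<phi>"]) (auto intro: lie_isomorphism_comp)
qed

text \<open>
Non-degeneracy makes an isometry injective, and finite dimension does the rest.
\<close>

lemma isometry_bij:
  fixes \<phi> :: "complex ^ 'm \<Rightarrow> complex ^ 'm"
  assumes lin: "clinear \<phi>" and iso: "\<And>x y. cf (\<phi> x) (\<phi> y) = cf x y"
  shows "bij \<phi>"
proof -
  have "inj \<phi>"
  proof (rule injI)
    fix x y assume "\<phi> x = \<phi> y"
    then have "cf (x - y) z = 0" for z
      using iso[of "x - y" z] by (simp add: clinear_simps[OF lin] cf_zero_left)
    then show "x = y"
      using cf_nondegenerate[of "x - y"] by simp
  qed
  then show ?thesis
    using lin vec.linear_inj_imp_surj[of \<phi>] by (simp add: bij_def clinear_def)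
qed

lemma dext_i_isomorphism:
  assumes lin: "clinear \<phi>" and iso: "\<And>x y. cf (\<phi> x) (\<phi> y) = cf x y"
    and C: "\<And>x. \<phi> (C x) = C' (\<phi> x)" and X: "\<phi> X = X'"
  shows "i_isomorphism (dext C X) cf (dext C' X') cf \<phi>"
proof -
  have "\<phi> (dext C X x y) = dext C' X' (\<phi> x) (\<phi> y)" for x y
    by (simp add: dext_def clinear_simps[OF lin] iso X[symmetric] C[symmetric])
  then show ?thesis
    using lin iso isometry_bij[OF lin iso] by (simp add: i_isomorphism_def lie_isomorphism_def)
qed

section \<open>Orthonormal families and eigenvectors\<close>

definition orthonormal_on :: "'m set \<Rightarrow> ('m \<Rightarrow> complex ^ 'm) \<Rightarrow> bool" where
  "orthonormal_on S f \<longleftrightarrow> (\<forall>k\<in>S. \<forall>l\<in>S. cf (f k) (f l) = (if k = l then 1 else 0))"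

text \<open>
The component of a vector orthogonal to an orthonormal family. Working with families indexed by the
coordinates lets the orthogonal complements of the classical argument appear only through this
projection.
\<close>

definition residue_on :: "'m set \<Rightarrow> ('m \<Rightarrow> complex ^ 'm) \<Rightarrow> complex ^ 'm \<Rightarrow> complex ^ 'm" where
  "residue_on S f x = x - (\<Sum>k\<in>S. cf x (f k) *s f k)"

lemma clinear_residue: "clinear (residue_on S f)"
  unfolding clinear_iff residue_on_def
  by (auto simp: cf_simps sum.distrib vec.scale_left_distrib vec.scale_right_diff_distrib
      vec.scale_sum_right)

lemma residue_orthogonal:
  fixes f :: "'m::finite \<Rightarrow> complex ^ 'm"
  assumes "orthonormal_on S f" "l \<in> S"
  shows "cf (residue_on S f x) (f l) = 0"
proof -
  have "(\<Sum>k\<in>S. cf x (f k) * cf (f k) (f l)) = (\<Sum>k\<in>S. if k = l then cf x (f k) else 0)"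
    using assms by (intro sum.cong) (auto simp: orthonormal_on_def)
  also have "\<dots> = cf x (f l)"
    using assms(2) by simp
  finally show ?thesis
    by (simp add: residue_on_def cf_diff_left cf_sum_left cf_scale_left)
qed

lemma residue_fixed: "(\<And>k. k \<in> S \<Longrightarrow> cf x (f k) = 0) \<Longrightarrow> residue_on S f x = x"
  by (simp add: residue_on_def)

lemma residue_in_family:
  fixes f :: "'m::finite \<Rightarrow> complex ^ 'm"
  assumes "orthonormal_on S f" "l \<in> S"
  shows "residue_on S f (f l) = 0"
proof -
  have "(\<Sum>k\<in>S. cf (f l) (f k) *s f k) = (\<Sum>k\<in>S. if k = l then f l else 0)"
    using assms by (intro sum.cong) (auto simp: orthonormal_on_def)
  then show ?thesis
    using assms(2) by (simp add: residue_on_def)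
qed

lemma cf_residue:
  fixes f :: "'m::finite \<Rightarrow> complex ^ 'm"
  assumes "\<And>k. k \<in> S \<Longrightarrow> cf u (f k) = 0"
  shows "cf u (residue_on S f x) = cf u x"
  using assms by (simp add: residue_on_def cf_diff_right cf_sum_right cf_scale_right)

lemma exists_nonzero_residue:
  fixes f :: "'m::finite \<Rightarrow> complex ^ 'm"
  assumes "card S < CARD('m)"
  shows "\<exists>x. residue_on S f x \<noteq> 0"
proof (rule ccontr)
  assume "\<not> ?thesis"
  then have x: "x = (\<Sum>k\<in>S. cf x (f k) *s f k)" for x
    by (simp add: residue_on_def)
  have "x \<in> vec.span (f ` S)" for x
    by (subst x) (intro vec.span_sum vec.span_scale vec.span_base imageI)
  then have "vec.dim (UNIV :: (complex ^ 'm) set) \<le> card (f ` S)"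
    by (intro vec.dim_le_card) auto
  also have "\<dots> \<le> card S"
    by (simp add: card_image_le)
  finally show False
    using assms unfolding vec_dim_card by simp
qed

text \<open>
If the form vanished on all squares in the orthogonal complement, polarization would make it vanish
on the complement altogether; since the projection onto the complement is self-adjoint, its image
would be the radical of the whole space, hence zero.
\<close>

lemma exists_unit_vector:
  fixes f :: "'m::finite \<Rightarrow> complex ^ 'm"
  assumes S: "orthonormal_on S f" and card: "card S < CARD('m)"
  obtains e where "cf e e = 1" "\<And>k. k \<in> S \<Longrightarrow> cf e (f k) = 0"
proof -
  let ?P = "residue_on S f"
  note lin = clinear_simps[OF clinear_residue[of S f]]
  have "\<exists>x. cf (?P x) (?P x) \<noteq> 0"
  proof (rule ccontr)
    assume "\<not> ?thesis"
    then have isotropic: "cf (?P x) (?P x) = 0" for x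
      by blast
    have "cf (?P x) y = 0" for x y
    proof -
      have "2 * cf (?P x) (?P y) = 0"
        using isotropic[of "x + y"] isotropic[of x] isotropic[of y]
        by (simp add: lin cf_simps cf_commute[of "?P y" "?P x"] flip: mult_2)
      then show ?thesis
        using cf_residue[of S "?P x" f y] residue_orthogonal[OF S] by simp
    qed
    then show False
      using cf_nondegenerate exists_nonzero_residue[OF card] by blast
  qed
  then obtain x where x: "cf (?P x) (?P x) \<noteq> 0" ..
  show ?thesis
  proof
    let ?c = "1 / csqrt (cf (?P x) (?P x))"
    have "?c * ?c * cf (?P x) (?P x) = 1"
      using x power2_csqrt[of "cf (?P x) (?P x)"] by (simp add: field_simps power2_eq_square)
    then show "cf (?c *s ?P x) (?c *s ?P x) = 1"
      by (simp add: cf_simps mult.assoc)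
    show "cf (?c *s ?P x) (f k) = 0" if "k \<in> S" for k
      using residue_orthogonal[OF S that] by (simp add: cf_simps)
  qed
qed

text \<open>
The span of the family is stable under the skew map, so its orthogonal complement is stable too.
\<close>

lemma residue_commute:
  fixes f :: "'m::finite \<Rightarrow> complex ^ 'm"
  assumes S: "orthonormal_on S f" and C: "skew C"
    and inv: "\<And>k. k \<in> S \<Longrightarrow> \<exists>c. \<exists>l\<in>S. C (f k) = c *s f l"
  shows "C (residue_on S f x) = residue_on S f (C x)"
proof -
  let ?P = "residue_on S f"
  note lin = clinear_simps[OF clinear_residue[of S f]] and linC = clinear_simps[OF skew_clinear[OF C]]
  have kill: "?P (C (f k)) = 0" if "k \<in> S" for k
  proof -
    obtain c l where "l \<in> S" "C (f k) = c *s f l"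
      using inv \<open>k \<in> S\<close> by blast
    then show ?thesis
      by (simp add: lin residue_in_family[OF S])
  qed
  have "cf (C (?P x)) (f k) = 0" if k: "k \<in> S" for k
  proof -
    obtain c l where l: "l \<in> S" and Cf: "C (f k) = c *s f l"
      using inv[OF k] by blast
    show ?thesis
      by (simp add: skew_cf[OF C] Cf cf_simps residue_orthogonal[OF S l])
  qed
  then have "C (?P x) = ?P (C (?P x))"
    by (simp add: residue_fixed)
  also have "\<dots> = ?P (C x) - (\<Sum>k\<in>S. cf x (f k) *s ?P (C (f k)))"
    by (simp add: residue_on_def[of S f x] linC lin clinear_sum[OF skew_clinear[OF C]]
        clinear_sum[OF clinear_residue])
  also have "\<dots> = ?P (C x)"
    by (simp add: kill)
  finally show ?thesis .
qed

definition frame_map :: "('m \<Rightarrow> complex ^ 'm) \<Rightarrow> complex ^ 'm \<Rightarrow> complex ^ 'm" where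
  "frame_map f x = (\<Sum>k\<in>UNIV. x $ k *s f k)"

lemma clinear_frame_map: "clinear (frame_map f)"
  by (simp add: clinear_iff frame_map_def vec.scale_left_distrib sum.distrib vec.scale_sum_right)

lemma frame_map_axis: "frame_map f (axis k 1) = f k"
proof -
  have "frame_map f (axis k 1) = (\<Sum>l\<in>UNIV. if l = k then f k else 0)"
    unfolding frame_map_def by (intro sum.cong) (auto simp: axis_def)
  then show ?thesis by simp
qed

lemma frame_map_isometry:
  assumes "orthonormal_on UNIV f"
  shows "cf (frame_map f x) (frame_map f y) = cf x y"
proof -
  have "cf (frame_map f x) (frame_map f y) = (\<Sum>l\<in>UNIV. \<Sum>k\<in>UNIV. y $ l * (x $ k * cf (f k) (f l)))"
    by (simp add: frame_map_def cf_sum_left cf_sum_right cf_simps sum_distrib_left)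
  also have "\<dots> = (\<Sum>l\<in>UNIV. \<Sum>k\<in>UNIV. if k = l then x $ k * y $ k else 0)"
    using assms by (intro sum.cong) (auto simp: orthonormal_on_def)
  finally show ?thesis
    by (simp add: canonical_form_def)
qed

lemma orthonormal_complete:
  assumes f: "orthonormal_on UNIV f" and orth: "\<And>k. cf x (f k) = 0"
  shows "x = 0"
proof -
  have "surj (frame_map f)"
    using isometry_bij[OF clinear_frame_map frame_map_isometry[OF f]] by (rule bij_is_surj)
  then obtain y where y: "x = frame_map f y"
    by blast
  have "y $ k = 0" for k
    using orth[of k] frame_map_isometry[OF f, of y "axis k 1"]
    by (simp add: y frame_map_axis cf_axis_right)
  then have "y = 0"
    by (simp add: vec_eq_iff)
  then show ?thesis
    by (simp add: y clinear_simps[OF clinear_frame_map])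
qed

definition spanned_by_eigenvectors :: "(complex ^ 'm \<Rightarrow> complex ^ 'm) \<Rightarrow> bool" where
  "spanned_by_eigenvectors C \<longleftrightarrow> vec.span {v. \<exists>c. C v = c *s v} = UNIV"

text \<open>
The form in which diagonalizability is used: a linear map is determined by its values on
eigenvectors.
\<close>

lemma clinear_zero_on_eigenvectors:
  assumes span: "spanned_by_eigenvectors C" and g: "clinear g"
    and zero: "\<And>w c. C w = c *s w \<Longrightarrow> g w = 0"
  shows "g x = 0"
proof -
  have "x \<in> vec.span {v. \<exists>c. C v = c *s v}"
    using span by (simp add: spanned_by_eigenvectors_def)
  then show ?thesis
    by (induction rule: vec.span_induct_alt) (auto simp: clinear_simps[OF g] dest: zero)
qed

text \<open>
The inductive step of the simultaneous normal form. If the complement of the family contains an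
eigenvector \<open>u\<close> for $a \neq 0$, some eigenvector pairs non-trivially with \<open>u\<close>; skewness forces
its eigenvalue to be $-a$ and both vectors to be isotropic, and the sum and the difference of
suitable multiples are the required pair. Otherwise diagonalizability makes the map vanish on the
complement, and any two orthonormal vectors in it do, with $a = 0$.
\<close>

lemma exists_rotation_pair:
  fixes f :: "'m::finite \<Rightarrow> complex ^ 'm"
  assumes S: "orthonormal_on S f" and C: "skew C"
    and inv: "\<And>k. k \<in> S \<Longrightarrow> \<exists>c. \<exists>l\<in>S. C (f k) = c *s f l"
    and span: "spanned_by_eigenvectors C" and card: "card S + 2 \<le> CARD('m)"
  obtains E F a where "cf E E = 1" "cf F F = 1" "cf E F = 0"
    "\<And>k. k \<in> S \<Longrightarrow> cf E (f k) = 0" "\<And>k. k \<in> S \<Longrightarrow> cf F (f k) = 0"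
    "C E = (\<i> * a) *s F" "C F = (- \<i> * a) *s E"
proof (cases "\<exists>u a. u \<noteq> 0 \<and> a \<noteq> 0 \<and> C u = a *s u \<and> (\<forall>k\<in>S. cf u (f k) = 0)")
  case True
  then obtain u a where u: "u \<noteq> 0" "a \<noteq> 0" "C u = a *s u" "\<And>k. k \<in> S \<Longrightarrow> cf u (f k) = 0"
    by blast
  let ?P = "residue_on S f"
  obtain w b where w: "C w = b *s w" "cf u w \<noteq> 0"
  proof -
    have "\<exists>w b. C w = b *s w \<and> cf u w \<noteq> 0"
    proof (rule ccontr)
      assume *: "\<not> ?thesis"
      have "cf u x *s u = 0" for x
        by (rule clinear_zero_on_eigenvectors[OF span, of "\<lambda>x. cf u x *s u"])
          (use * in \<open>auto simp: clinear_iff cf_simps vec.scale_left_distrib\<close>)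
      then show False
        using u(1) cf_nondegenerate[of u] by auto
    qed
    then show ?thesis
      using that by blast
  qed
  \<comment> \<open>With the normalization \<open>cf u w' = 1 / 2\<close> the sum of \<open>u\<close> and \<open>w'\<close> is a unit vector.\<close>
  define w' where "w' = (1 / (2 * cf u w)) *s ?P w"
  have Pw: "C (?P w) = b *s ?P w"
    by (simp add: residue_commute[OF S C inv] w(1) clinear_simps[OF clinear_residue])
  have uw: "cf u w' = 1 / 2"
    using w(2) by (simp add: w'_def cf_simps cf_residue u(4))
  then have wu: "cf w' u = 1 / 2"
    by (simp add: cf_commute)
  have Cw: "C w' = b *s w'"
    by (simp add: w'_def clinear_simps[OF skew_clinear[OF C]] Pw mult.commute)
  have "b = - a"
    using skew_cf[OF C, of u w'] by (simp add: u(3) Cw cf_simps uw field_simps)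
  have "a * cf u u = 0" "b * cf w' w' = 0"
    using skew_cf_self[OF C, of u] skew_cf_self[OF C, of w'] by (simp_all add: u(3) Cw cf_simps)
  then have uu: "cf u u = 0" and ww: "cf w' w' = 0"
    using u(2) \<open>b = - a\<close> by auto
  have w'S: "cf w' (f k) = 0" if "k \<in> S" for k
    by (simp add: w'_def cf_simps residue_orthogonal[OF S that])
  let ?E = "u + w'" and ?F = "(- \<i>) *s (u - w')"
  show ?thesis
  proof (rule that)
    show "cf ?E ?E = 1" "cf ?F ?F = 1" "cf ?E ?F = 0"
      by (simp_all add: cf_simps uu ww uw wu)
    show "cf ?E (f k) = 0" "cf ?F (f k) = 0" if "k \<in> S" for k
      using that by (simp_all add: cf_simps u(4) w'S)
    show "C ?E = (\<i> * a) *s ?F" "C ?F = (- \<i> * a) *s ?E"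
      by (simp_all add: clinear_simps[OF skew_clinear[OF C]] u(3) Cw \<open>b = - a\<close> vec_eq_iff
          algebra_simps)
  qed
next
  case False
  have kernel: "C x = 0" if x: "\<And>k. k \<in> S \<Longrightarrow> cf x (f k) = 0" for x
  proof -
    have "C (residue_on S f x) = 0"
    proof (rule clinear_zero_on_eigenvectors[OF span, of "\<lambda>x. C (residue_on S f x)"])
      show "clinear (\<lambda>x. C (residue_on S f x))"
        by (rule clinear_comp[OF skew_clinear[OF C] clinear_residue])
      fix w c assume w: "C w = c *s w"
      have "C (residue_on S f w) = c *s residue_on S f w"
        by (simp add: residue_commute[OF S C inv] w clinear_simps[OF clinear_residue])
      then show "C (residue_on S f w) = 0"
        using False residue_orthogonal[OF S, of _ w] clinear_simps(3)[OF skew_clinear[OF C]]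
        by (cases "c = 0 \<or> residue_on S f w = 0") auto
    qed
    then show ?thesis
      by (simp add: residue_fixed x)
  qed
  obtain E where E: "cf E E = 1" "\<And>k. k \<in> S \<Longrightarrow> cf E (f k) = 0"
    using exists_unit_vector[OF S] card by auto
  \<comment> \<open>The index \<open>k0\<close> is free; under it \<open>E\<close> joins the family before \<open>F\<close> is chosen.\<close>
  obtain k0 where k0: "k0 \<notin> S"
    using card by (metis UNIV_eq_I add_leD1 add_le_same_cancel1 not_numeral_le_zero)
  let ?f = "f(k0 := E)"
  have "orthonormal_on (insert k0 S) ?f"
    using S E k0 by (auto simp: orthonormal_on_def cf_commute)
  moreover have "card (insert k0 S) < CARD('m)"
    using card k0 by (simp add: card_insert_if)
  ultimately obtain F where F: "cf F F = 1" "\<And>k. k \<in> insert k0 S \<Longrightarrow> cf F (?f k) = 0"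
    using exists_unit_vector by blast
  have FS: "cf F (f k) = 0" if "k \<in> S" for k
    using F(2)[of k] that k0 by (auto split: if_splits)
  show ?thesis
  proof (rule that[of E F 0])
    show "cf E F = 0"
      using F(2)[of k0] by (simp add: cf_commute)
  qed (use E F(1) FS in \<open>auto simp: kernel\<close>)
qed

section \<open>Diagonalizable structures as double extensions\<close>

text \<open>
The map is \<open>br Y\<close> on the whole space. Its skewness is a consequence of the invariance of the form,
and its eigenvectors span because it kills the hyperbolic plane.
\<close>

lemma diag_structure_dext:
  assumes "br \<in> diag_structures"
  obtains C X Y where "br = dext C X" "skew C" "spanned_by_eigenvectors C" "C X = 0" "C Y = 0"
    "cf X X = 0" "cf Y Y = 0" "cf X Y = 1" "\<exists>x. C x \<noteq> 0"
proof -
  obtain X Y q C where quad: "quadratic_lie_algebra br cf" and nonab: "\<not> abelian_bracket br"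
    and dec: "double_ext_decomp br cf X Y q C" and diag: "diagonalizable_on q C"
    using assms
    unfolding diag_structures_def diagonalizable_singular_def singular_quadratic_def by blast
  have lie: "\<And>x. clinear (br x)" "\<And>y. clinear (\<lambda>x. br x y)" "\<And>x. br x x = 0"
    and invar: "\<And>x y z. cf (br x y) z = cf x (br y z)"
    using quad by (auto simp: quadratic_lie_algebra_def lie_bracket_def)
  have XY: "cf X X = 0" "cf Y Y = 0" "cf X Y = 1" and q0: "0 \<in> q"
    and perp: "\<And>x. x \<in> q \<Longrightarrow> cf X x = 0" "\<And>x. x \<in> q \<Longrightarrow> cf Y x = 0"
    and split: "\<And>v. \<exists>x \<in> q. \<exists>l m. v = x + l *s X + m *s Y"
    and C: "\<And>x. x \<in> q \<Longrightarrow> C x = br Y x" "\<And>x. x \<in> q \<Longrightarrow> C x \<in> q"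
    and br: "\<And>x y l m l' m'. x \<in> q \<Longrightarrow> y \<in> q \<Longrightarrow>
        br (x + l *s X + m *s Y) (y + l' *s X + m' *s Y) =
        m *s C y - m' *s C x + cf (C x) y *s X"
    using dec unfolding double_ext_decomp_def by (auto simp: vec.subspace_0)
  let ?D = "br Y"
  note lin = clinear_simps[OF lie(1)[of Y]]
  have "C 0 = 0"
    using C(1)[OF q0] lin(3) by simp
  then have DX: "?D X = 0"
    using br[OF q0 q0, of 0 1 1 0] by (simp add: cf_simps)
  have DY: "?D Y = 0"
    by (rule lie(3))
  have antisym: "br x y = - br y x" for x y
  proof -
    have "br (x + y) (x + y) = br x x + br x y + (br y x + br y y)"
      by (simp add: clinear_simps(1)[OF lie(1)] clinear_simps(1)[OF lie(2)])
    then show ?thesis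
      by (simp add: lie(3) eq_neg_iff_add_eq_0)
  qed
  have "cf (?D x) y = - cf x (?D y)" for x y
  proof -
    have "cf (?D x) y = - cf (br x Y) y"
      by (subst antisym) (simp add: canonical_form_def sum_negf)
    then show ?thesis
      by (simp add: invar)
  qed
  then have skew: "skew ?D"
    by (simp add: skew_def lie(1))
  have "br x y = dext ?D X x y" for x y
  proof -
    obtain x' l m y' l' m' where "x' \<in> q" "y' \<in> q"
      and x: "x = x' + l *s X + m *s Y" and y: "y = y' + l' *s X + m' *s Y"
      using split by meson
    have "cf X x = m" "cf X y = m'"
      using perp(1)[OF \<open>x' \<in> q\<close>] perp(1)[OF \<open>y' \<in> q\<close>] by (simp_all add: x y cf_simps XY)
    moreover have "?D x = C x'" "?D y = C y'"
      using C(1)[OF \<open>x' \<in> q\<close>] C(1)[OF \<open>y' \<in> q\<close>] by (simp_all add: x y lin DX DY)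
    moreover have "cf (C x') y = cf (C x') y'"
      using perp[OF C(2)[OF \<open>x' \<in> q\<close>]] by (simp add: y cf_simps cf_commute[of "C x'"])
    ultimately show ?thesis
      using br[OF \<open>x' \<in> q\<close> \<open>y' \<in> q\<close>, of l m l' m'] by (simp add: dext_def x[symmetric] y[symmetric])
  qed
  then have eq: "br = dext ?D X"
    by (intro ext)
  have "spanned_by_eigenvectors ?D"
  proof -
    let ?E = "{v. \<exists>c. ?D v = c *s v}"
    obtain b where b: "b \<subseteq> q" "vec.span b = q" "\<And>v. v \<in> b \<Longrightarrow> \<exists>c. C v = c *s v"
      using diag by (auto simp: diagonalizable_on_def)
    have "v \<in> ?E" if "v \<in> b" for v
    proof -
      obtain c where "C v = c *s v"
        using b(3)[OF \<open>v \<in> b\<close>] by blast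
      then have "?D v = c *s v"
        using C(1)[of v] b(1) \<open>v \<in> b\<close> by auto
      then show ?thesis
        by blast
    qed
    then have "b \<subseteq> ?E"
      by blast
    then have q: "q \<subseteq> vec.span ?E"
      using b(2) vec.span_mono by blast
    have "X \<in> ?E" "Y \<in> ?E"
      by (auto simp: DX DY intro: exI[of _ 0])
    then have XY: "X \<in> vec.span ?E" "Y \<in> vec.span ?E"
      by (simp_all only: vec.span_base)
    have "v \<in> vec.span ?E" for v
    proof -
      obtain x l m where "x \<in> q" and v: "v = x + l *s X + m *s Y"
        using split by meson
      have "x \<in> vec.span ?E"
        using q \<open>x \<in> q\<close> by blast
      then show ?thesis
        unfolding v by (intro vec.span_add vec.span_scale XY)
    qed
    then show ?thesis
      by (auto simp: spanned_by_eigenvectors_def)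
  qed
  moreover have "\<exists>x. ?D x \<noteq> 0"
  proof (rule ccontr)
    assume "\<not> ?thesis"
    then have "br x y = 0" for x y
      by (subst eq) (simp add: dext_def cf_simps)
    then show False
      using nonab by (simp add: abelian_bracket_def)
  qed
  ultimately show ?thesis
    using that[OF eq skew _ DX DY XY] by blast
qed

text \<open>
A non-zero element gives a positive dimension only because linear functionals are spanned by the
finitely many coordinate functionals: in the space of all functions, the dimension of a subset
without a finite basis would count as $0$.
\<close>

lemma dup_pos:
  fixes br :: "complex ^ 'm \<Rightarrow> complex ^ 'm \<Rightarrow> complex ^ 'm"
  assumes \<alpha>: "\<alpha> \<in> dup_space br B" "\<alpha> x \<noteq> 0"
  shows "dup br B \<ge> 1"
proof -
  interpret F: vector_space "\<lambda>(c::complex) (\<alpha> :: complex ^ 'm \<Rightarrow> complex) x. c * \<alpha> x"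
    by (rule vector_space_pointwise)
  let ?coord = "range (\<lambda>k (x :: complex ^ 'm). x $ k)"
  have "\<beta> \<in> F.span ?coord" if "lin_functional \<beta>" for \<beta>
  proof -
    have lin: "\<And>x y. \<beta> (x + y) = \<beta> x + \<beta> y" "\<And>c x. \<beta> (c *s x) = c * \<beta> x"
      using that by (simp_all add: lin_functional_iff)
    have "\<beta> 0 = 0"
      using lin(2)[of 0 0] by simp
    then have sum: "\<beta> (sum g A) = (\<Sum>a\<in>A. \<beta> (g a))" for g :: "'m \<Rightarrow> _" and A
      by (induction A rule: infinite_finite_induct) (auto simp: lin)
    have expand: "\<beta> x = (\<Sum>k\<in>UNIV. \<beta> (axis k 1) * x $ k)" for x
    proof -
      have "\<beta> x = \<beta> (\<Sum>k\<in>UNIV. x $ k *s axis k 1)"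
        by (simp only: basis_expansion)
      then show ?thesis
        by (simp only: sum lin mult.commute)
    qed
    have apply_sum: "(\<Sum>k\<in>A. h k) x = (\<Sum>k\<in>A. h k x)"
      for h :: "'m \<Rightarrow> complex ^ 'm \<Rightarrow> complex" and A x
      by (induction A rule: infinite_finite_induct) auto
    have "\<beta> = (\<Sum>k\<in>UNIV. (\<lambda>x. \<beta> (axis k 1) * x $ k))"
      by (intro ext) (simp only: apply_sum, rule expand)
    moreover have "(\<lambda>x. \<beta> (axis k 1) * x $ k) \<in> F.span ?coord" for k
      by (rule F.span_scale[OF F.span_base[OF rangeI]])
    then have "(\<Sum>k\<in>UNIV. (\<lambda>x. \<beta> (axis k 1) * x $ k)) \<in> F.span ?coord"
      by (rule F.span_sum)
    ultimately show ?thesis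
      by (simp only:)
  qed
  then have sub: "dup_space br B \<subseteq> F.span ?coord"
    by (auto simp: dup_space_def)
  obtain b where b: "b \<subseteq> dup_space br B" "F.independent b" "dup_space br B \<subseteq> F.span b"
    "card b = F.dim (dup_space br B)"
    using F.basis_exists by blast
  have "finite b"
    using F.independent_span_bound[of ?coord b] b sub by auto
  moreover have "b \<noteq> {}"
  proof
    assume "b = {}"
    then have "\<alpha> = 0"
      using b(3) \<alpha>(1) by auto
    then show False
      using \<alpha>(2) by simp
  qed
  ultimately have "card b \<ge> 1"
    by (simp add: Suc_le_eq card_gt_0_iff)
  then show ?thesis
    using b(4) by (simp add: dup_def)
qed

text \<open>
The first derived algebra is orthogonal to \<open>X\<close>, the second is contained in the line of \<open>X\<close>, and
the third vanishes.
\<close>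

lemma dext_solvable:
  assumes C: "skew C" and CX: "C X = 0" and XX: "cf X X = 0"
  shows "lie_solvable (dext C X)"
proof -
  let ?D = "derived_series (dext C X)"
  have "?D (Suc 0) \<subseteq> {x. cf X x = 0}"
    unfolding derived_series.simps
    by (rule vec.span_minimal)
      (auto simp: vec.subspace_def cf_simps dext_def skew_cf_kernel[OF C CX] XX)
  then have D1: "cf X x = 0" if "x \<in> ?D (Suc 0)" for x
    using that by blast
  have "?D (Suc (Suc 0)) \<subseteq> vec.span {X}"
    unfolding derived_series.simps(2)[of _ "Suc 0"]
  proof (rule vec.span_minimal[OF _ vec.subspace_span], rule subsetI)
    fix z assume "z \<in> {dext C X x y |x y. x \<in> ?D (Suc 0) \<and> y \<in> ?D (Suc 0)}"
    then obtain x y where z: "z = dext C X x y" and "x \<in> ?D (Suc 0)" "y \<in> ?D (Suc 0)"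
      by blast
    then have "cf X x = 0" "cf X y = 0"
      using D1 by blast+
    then show "z \<in> vec.span {X}"
      by (simp add: z dext_def vec.span_scale vec.span_base)
  qed
  then have D2: "\<exists>c. x = c *s X" if "x \<in> ?D (Suc (Suc 0))" for x
    using that unfolding vec.span_singleton by blast
  have "dext C X x y = 0" if x: "x \<in> ?D (Suc (Suc 0))" and y: "y \<in> ?D (Suc (Suc 0))" for x y
  proof -
    obtain c d where "x = c *s X" "y = d *s X"
      using D2[OF x] D2[OF y] by blast
    then show ?thesis
      by (simp add: dext_def cf_simps XX clinear_simps[OF skew_clinear[OF C]] CX)
  qed
  then have "{dext C X x y |x y. x \<in> ?D (Suc (Suc 0)) \<and> y \<in> ?D (Suc (Suc 0))} \<subseteq> {0}"
    by blast
  then have "?D (Suc (Suc (Suc 0))) \<subseteq> vec.span {0}"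
    unfolding derived_series.simps(2)[of _ "Suc (Suc 0)"] by (rule vec.span_mono)
  then have "?D (Suc (Suc (Suc 0))) \<subseteq> {0}"
    by simp
  moreover have "0 \<in> ?D (Suc (Suc (Suc 0)))"
    unfolding derived_series.simps(2)[of _ "Suc (Suc 0)"] by (rule vec.span_zero)
  ultimately show ?thesis
    unfolding lie_solvable_def by blast
qed

text \<open>
The form \<open>cf X\<close> divides the canonical 3-form, which is its product with the 2-form
\<open>\<lambda>x y. cf (C x) y\<close>; so it lies in the space that defines dup. The orthogonal complement of the hyperbolic
plane is the subspace \<open>q\<close>, and the projection onto it maps eigenvectors to eigenvectors.
\<close>

lemma dext_in_diag_structures:
  assumes C: "skew C" and span: "spanned_by_eigenvectors C"
    and CX: "C X = 0" and CY: "C Y = 0" and XY: "cf X X = 0" "cf Y Y = 0" "cf X Y = 1"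
    and nonzero: "C x0 \<noteq> 0"
  shows "dext C X \<in> diag_structures"
proof -
  note lin = clinear_simps[OF skew_clinear[OF C]]
  have YX: "cf Y X = 1"
    using XY by (simp add: cf_commute)
  have C_perp: "cf X (C x) = 0" "cf Y (C x) = 0" for x
    using skew_cf_kernel[OF C] CX CY by auto
  have nonab: "\<not> abelian_bracket (dext C X)"
  proof -
    have "dext C X Y x0 = C x0"
      by (simp add: dext_def XY CY cf_simps)
    then show ?thesis
      using nonzero unfolding abelian_bracket_def by metis
  qed
  have "cf X \<in> dup_space (dext C X) cf"
    unfolding dup_space_def wedge_1_3_def canonical_3form_def dext_def lin_functional_iff
    by (auto simp: cf_simps algebra_simps)
  then have dup: "dup (dext C X) cf \<ge> 1"
    using XY(3) by (intro dup_pos[of "cf X" _ _ Y]) auto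
  define q where "q = {x. cf X x = 0 \<and> cf Y x = 0}"
  define P where "P x = x - cf Y x *s X - cf X x *s Y" for x
  have P_lin: "clinear P"
    by (simp add: clinear_iff P_def cf_simps vec_eq_iff algebra_simps)
  have P_q: "P x \<in> q" for x
    by (simp add: P_def q_def cf_simps XY YX)
  have P_fix: "P x = x" if "x \<in> q" for x
    using that by (simp add: P_def q_def)
  have sub: "vec.subspace q"
    by (auto simp: q_def vec.subspace_def cf_simps)
  have plane: "P x = 0" if "x \<in> vec.span {X, Y}" for x
    using that by (induction rule: vec.span_induct_alt)
      (auto simp: clinear_simps[OF P_lin], auto simp: P_def XY YX)
  have dec: "double_ext_decomp (dext C X) cf X Y q C"
    unfolding double_ext_decomp_def
  proof (intro conjI ballI allI)
    show "vec.span {X, Y} \<inter> q = {0}"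
    proof (intro equalityI subsetI)
      fix x assume "x \<in> vec.span {X, Y} \<inter> q"
      then show "x \<in> {0}"
        using plane[of x] P_fix[of x] by simp
    qed (simp add: vec.span_zero vec.subspace_0[OF sub])
    show "\<exists>x\<in>q. \<exists>l m. v = x + l *s X + m *s Y" for v
      by (rule bexI[OF _ P_q[of v]], rule exI[of _ "cf Y v"], rule exI[of _ "cf X v"])
        (simp add: P_def)
    show "dext C X (x + l *s X + m *s Y) (y + l' *s X + m' *s Y) =
        m *s C y - m' *s C x + cf (C x) y *s X" if "x \<in> q" "y \<in> q" for x y l m l' m'
      using that C_perp by (simp add: dext_def lin CX CY cf_simps XY q_def cf_commute[of "C x"])
    show "C x = dext C X Y x" if "x \<in> q" for x
      using that by (simp add: dext_def XY CY cf_simps)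
  qed (use XY sub C_perp in \<open>auto simp: q_def skew_cf[OF C]\<close>)
  have diag: "diagonalizable_on q C"
  proof -
    let ?V = "{x \<in> q. \<exists>c. C x = c *s x}"
    have "x \<in> vec.span ?V" if "x \<in> q" for x
    proof -
      have "x \<in> vec.span {v. \<exists>c. C v = c *s v}"
        using span by (simp add: spanned_by_eigenvectors_def)
      then have "P x \<in> vec.span ?V"
      proof (induction rule: vec.span_induct_alt)
        case base
        then show ?case
          by (simp add: clinear_simps[OF P_lin] vec.span_zero)
      next
        case (step c w y)
        then obtain d where d: "C w = d *s w"
          by blast
        have "C (P w) = C w"
          by (simp add: P_def lin CX CY)
        also have "\<dots> = P (C w)"
          by (simp add: P_def C_perp)
        finally have "C (P w) = d *s P w"
          by (simp add: d clinear_simps[OF P_lin])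
        then have "P w \<in> vec.span ?V"
          using P_q by (intro vec.span_base) blast
        then show ?case
          using step(2) by (simp add: clinear_simps[OF P_lin] vec.span_add vec.span_scale)
      qed
      then show ?thesis
        by (simp add: P_fix that)
    qed
    moreover have "vec.span ?V \<subseteq> q"
      using sub by (intro vec.span_minimal) auto
    ultimately have "vec.span ?V = q"
      by blast
    obtain b where b: "b \<subseteq> ?V" "vec.independent b" "?V \<subseteq> vec.span b"
      using vec.maximal_independent_subset by blast
    have "vec.span ?V \<subseteq> vec.span b"
      using b(3) by (simp add: vec.span_minimal)
    then have "vec.span b = q"
      using vec.span_mono[OF b(1)] \<open>vec.span ?V = q\<close> by blast
    then show ?thesis
      using b(1,2) unfolding diagonalizable_on_def by blast
  qed
  show ?thesis
    unfolding diag_structures_def diagonalizable_singular_def singular_quadratic_def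
    using dext_quadratic[OF C CX XY(1)] nonab dup dext_solvable[OF C CX XY(1)] dec diag by blast
qed

section \<open>The group of signed permutations and scalings\<close>

lemma H_generators_bij:
  assumes "h \<in> H_generators"
  shows "bij h"
proof -
  consider \<pi> where "bij \<pi>" "h = (\<lambda>v. \<chi> i. v $ \<pi> i)"
    | s where "\<And>i. s i = 1 \<or> s i = (- 1 :: complex)" "h = (\<lambda>v. \<chi> i. s i * v $ i)"
    | c where "c \<noteq> 0" "h = (\<lambda>v. c *s v)"
    using assms unfolding H_generators_def by blast
  then show ?thesis
  proof cases
    case (1 \<pi>)
    let ?g = "\<lambda>v. \<chi> i. v $ inv_into UNIV \<pi> i"
    show ?thesis
      by (rule o_bij[of ?g])
        (use 1 in \<open>auto simp: fun_eq_iff vec_eq_iff bij_is_inj bij_is_surj surj_f_inv_f\<close>)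
  next
    case (2 s)
    have "s i * (s i * x) = x" for i x
      using 2(1)[of i] by auto
    then show ?thesis
      by (intro o_bij[of h]) (auto simp: 2(2) fun_eq_iff vec_eq_iff)
  next
    case (3 c)
    then show ?thesis
      by (intro o_bij[of "\<lambda>v. (1 / c) *s v"]) (auto simp: fun_eq_iff vec_eq_iff)
  qed
qed

text \<open>
Elements of the generated group as plain compositions, so that arguments about it need not refer to
the restricted composition of the group of bijections.
\<close>

lemma H_group_induct:
  fixes h :: "complex ^ 'a::finite \<Rightarrow> complex ^ 'a"
  assumes "h \<in> H_group"
    and id: "P id"
    and gen: "\<And>h. h \<in> H_generators \<Longrightarrow> P h"
    and inv: "\<And>g h. h \<in> H_generators \<Longrightarrow> h \<circ> g = id \<Longrightarrow> P g"
    and comp: "\<And>g h. P g \<Longrightarrow> P h \<Longrightarrow> P (g \<circ> h)"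
  shows "P h"
proof -
  interpret G: group "BijGroup (UNIV :: (complex ^ 'a) set)"
    by (rule group_BijGroup)
  have carrier: "H_generators \<subseteq> carrier (BijGroup UNIV)"
    by (auto simp: BijGroup_def Bij_def H_generators_bij)
  have mult: "g \<otimes>\<^bsub>BijGroup UNIV\<^esub> h = g \<circ> h"
    if "g \<in> carrier (BijGroup UNIV)" "h \<in> carrier (BijGroup UNIV)" for g h :: "complex ^ 'a \<Rightarrow> complex ^ 'a"
    using that by (auto simp: BijGroup_def compose_def fun_eq_iff)
  have one_eq: "\<one>\<^bsub>BijGroup UNIV\<^esub> = id"
    by (auto simp: BijGroup_def)
  have "h \<in> generate (BijGroup UNIV) H_generators"
    using assms(1) by (simp add: H_group_def)
  then show ?thesis
  proof (induction rule: generate.induct)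
    case one
    show ?case unfolding one_eq by (rule id)
  next
    case (incl h)
    then show ?case by (rule gen)
  next
    case (inv h)
    then have h: "h \<in> carrier (BijGroup UNIV)"
      using carrier by blast
    have "h \<circ> inv\<^bsub>BijGroup UNIV\<^esub> h = id"
      using mult[OF h G.inv_closed[OF h]] unfolding G.r_inv[OF h] one_eq by (rule sym)
    then show ?case
      by (rule assms(4)[OF inv(1)])
  next
    case (eng g h)
    have "g \<otimes>\<^bsub>BijGroup UNIV\<^esub> h = g \<circ> h"
      using eng(1,2) G.generate_in_carrier[OF carrier] by (intro mult)
    then show ?case
      using comp[OF eng(3,4)] by (simp only:)
  qed
qed

lemma H_group_generator: "h \<in> H_generators \<Longrightarrow> h \<in> H_group"
  by (simp add: H_group_def generate.incl)

lemma H_group_comp: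
  fixes g h :: "complex ^ 'a::finite \<Rightarrow> complex ^ 'a"
  assumes "g \<in> H_group" "h \<in> H_group"
  shows "g \<circ> h \<in> H_group"
proof -
  interpret G: group "BijGroup (UNIV :: (complex ^ 'a) set)"
    by (rule group_BijGroup)
  have carrier: "H_generators \<subseteq> carrier (BijGroup UNIV)"
    by (auto simp: BijGroup_def Bij_def H_generators_bij)
  have "g \<in> carrier (BijGroup UNIV)" "h \<in> carrier (BijGroup UNIV)"
    using assms G.generate_in_carrier[OF carrier] unfolding H_group_def by blast+
  then have "g \<otimes>\<^bsub>BijGroup UNIV\<^esub> h = g \<circ> h"
    by (auto simp: BijGroup_def compose_def fun_eq_iff)
  then show ?thesis
    using generate.eng[OF assms[unfolded H_group_def]] by (simp only: H_group_def)
qed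

lemma H_group_signed_permutation:
  fixes v :: "complex ^ 'a::finite" and \<pi> :: "'a \<Rightarrow> 'a"
  assumes "bij \<pi>" "\<And>i. s i = 1 \<or> s i = (- 1 :: complex)" "c \<noteq> 0"
  shows "\<exists>h\<in>H_group. (\<chi> i. s i * (c * v $ \<pi> i)) = h v"
proof
  let ?h1 = "\<lambda>v :: complex ^ 'a. \<chi> i. v $ \<pi> i" and ?h2 = "\<lambda>v. \<chi> i. s i * v $ i"
    and ?h3 = "\<lambda>v :: complex ^ 'a. c *s v"
  have h1: "?h1 \<in> H_generators"
    unfolding H_generators_def
    by (rule UnI1, rule UnI1, rule CollectI, rule exI[of _ \<pi>]) (simp add: assms(1))
  have h2: "?h2 \<in> H_generators"
    unfolding H_generators_def
    by (rule UnI1, rule UnI2, rule CollectI, rule exI[of _ s]) (simp add: assms(2))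
  have h3: "?h3 \<in> H_generators"
    unfolding H_generators_def
    by (rule UnI2, rule CollectI, rule exI[of _ c]) (simp add: assms(3))
  show "?h2 \<circ> (?h1 \<circ> ?h3) \<in> H_group"
    by (intro H_group_comp H_group_generator h1 h2 h3)
  show "(\<chi> i. s i * (c * v $ \<pi> i)) = (?h2 \<circ> (?h1 \<circ> ?h3)) v"
    by (simp add: vec_eq_iff)
qed

section \<open>The standard structures\<close>

text \<open>
The labels \<open>(Some j, _)\<close> name the two coordinates of the plane with parameter \<open>v $ j\<close>, and
\<open>(None, _)\<close> those of the hyperbolic plane. The bound on the dimension leaves at most one coordinate
without a label.
\<close>

locale paired_coordinates =
  fixes \<sigma> :: "'p::finite option \<times> bool \<Rightarrow> 'm::finite"
  assumes inj: "inj \<sigma>" and card_le: "CARD('m) \<le> 2 * CARD('p) + 3"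
begin

definition partner :: "'m \<Rightarrow> 'm" where
  "partner k = (if k \<in> range \<sigma> then \<sigma> (apsnd Not (inv_into UNIV \<sigma> k)) else k)"

text \<open>
Together with the partner, the matrix of the standard skew map: on the plane with label \<open>j\<close> the
vectors $e_{\mathrm{True}} \pm i e_{\mathrm{False}}$ are eigenvectors for $\pm v_j$.
\<close>

definition weight :: "complex ^ 'p \<Rightarrow> 'm \<Rightarrow> complex" where
  "weight v k = (if k \<in> range \<sigma>
     then (case inv_into UNIV \<sigma> k of
             (None, b) \<Rightarrow> 0 | (Some j, b) \<Rightarrow> (if b then - \<i> else \<i>) * v $ j)
     else 0)"

definition rot :: "complex ^ 'p \<Rightarrow> complex ^ 'm \<Rightarrow> complex ^ 'm" where
  "rot v x = (\<chi> k. weight v k * x $ partner k)"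

definition X0 :: "complex ^ 'm" where
  "X0 = (1 / 2) *s axis (\<sigma> (None, True)) 1 + (\<i> / 2) *s axis (\<sigma> (None, False)) 1"

definition Y0 :: "complex ^ 'm" where
  "Y0 = axis (\<sigma> (None, True)) 1 - \<i> *s axis (\<sigma> (None, False)) 1"

definition std :: "complex ^ 'p \<Rightarrow> complex ^ 'm \<Rightarrow> complex ^ 'm \<Rightarrow> complex ^ 'm" where
  "std v = dext (rot v) X0"

lemma \<sigma>_eq_iff [simp]: "\<sigma> a = \<sigma> b \<longleftrightarrow> a = b"
  using inj by (auto dest: injD)

lemma label_cases [case_names None Some free]:
  obtains b where "k = \<sigma> (None, b)" | j b where "k = \<sigma> (Some j, b)" | "k \<notin> range \<sigma>"
  by (metis imageE option.exhaust surj_pair)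

lemma partner_simps [simp]:
  "partner (\<sigma> (a, b)) = \<sigma> (a, \<not> b)" "k \<notin> range \<sigma> \<Longrightarrow> partner k = k"
  by (simp_all add: partner_def inj)

lemma weight_simps [simp]:
  "weight v (\<sigma> (None, b)) = 0"
  "weight v (\<sigma> (Some j, b)) = (if b then - \<i> else \<i>) * v $ j"
  "k \<notin> range \<sigma> \<Longrightarrow> weight v k = 0"
  by (simp_all add: weight_def inj)

lemma partner_partner [simp]: "partner (partner k) = k"
  by (cases k rule: label_cases) auto

lemma bij_partner: "bij partner"
  by (rule o_bij[of partner]) auto

lemma sum_partner: "(\<Sum>k\<in>UNIV. g (partner k)) = (\<Sum>k\<in>UNIV. g k)"
  using sum.reindex_bij_betw[OF bij_partner, of g] by simp

lemma weight_partner [simp]: "weight v (partner k) = - weight v k"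
  by (cases k rule: label_cases) auto

lemma weight_scale: "weight (c *s v) k = c * weight v k"
  by (cases k rule: label_cases) auto

lemma rot_nth [simp]: "rot v x $ k = weight v k * x $ partner k"
  by (simp add: rot_def)

lemma skew_rot: "skew (rot v)"
proof -
  have "cf (rot v x) y = - cf x (rot v y)" for x y
  proof -
    have "cf (rot v x) y = (\<Sum>k\<in>UNIV. weight v (partner k) * x $ k * y $ partner k)"
      unfolding canonical_form_def
      by (subst sum_partner[symmetric]) (simp add: mult.assoc)
    then show ?thesis
      by (simp add: canonical_form_def algebra_simps sum_negf)
  qed
  then show ?thesis
    by (simp add: skew_def clinear_iff vec_eq_iff algebra_simps)
qed

lemmas rot_simps = clinear_simps[OF skew_clinear[OF skew_rot]]

lemma rot_axis: "rot v (axis k 1) = - weight v k *s axis (partner k) 1"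
proof -
  have "partner l = k \<longleftrightarrow> l = partner k" for l
    using partner_partner by metis
  then show ?thesis
    by (auto simp: vec_eq_iff axis_def)
qed

lemma cf_X0: "cf X0 x = (x $ \<sigma> (None, True) + \<i> * x $ \<sigma> (None, False)) / 2"
  by (simp add: X0_def cf_simps cf_axis_left add_divide_distrib)

lemma cf_Y0: "cf Y0 x = x $ \<sigma> (None, True) - \<i> * x $ \<sigma> (None, False)"
  by (simp add: Y0_def cf_simps cf_axis_left)

lemma X0_nth: "X0 $ \<sigma> (None, True) = 1 / 2" "X0 $ \<sigma> (None, False) = \<i> / 2"
    "X0 $ \<sigma> (Some j, b) = 0" "k \<notin> range \<sigma> \<Longrightarrow> X0 $ k = 0"
  by (auto simp: X0_def axis_def)

lemma Y0_nth: "Y0 $ \<sigma> (None, True) = 1" "Y0 $ \<sigma> (None, False) = - \<i>"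
    "Y0 $ \<sigma> (Some j, b) = 0" "k \<notin> range \<sigma> \<Longrightarrow> Y0 $ k = 0"
  by (auto simp: Y0_def axis_def)

lemma hyperbolic_X0_Y0: "cf X0 X0 = 0" "cf Y0 Y0 = 0" "cf X0 Y0 = 1"
  by (simp_all add: cf_X0 cf_Y0 X0_nth Y0_nth)

lemma rot_X0: "rot v X0 = 0"
  by (simp add: X0_def rot_simps rot_axis)

lemma rot_Y0: "rot v Y0 = 0"
  by (simp add: Y0_def rot_simps rot_axis)

lemma std_quadratic: "quadratic_lie_algebra (std v) cf"
  unfolding std_def by (rule dext_quadratic[OF skew_rot rot_X0 hyperbolic_X0_Y0(1)])

section \<open>Recognising a standard structure from an orthonormal frame\<close>

text \<open>
The hypotheses say that the orthonormal basis \<open>f\<close> behaves under \<open>C\<close> and \<open>X\<close> as the coordinate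
axes do under the standard map (\<open>rot_axis\<close>) and \<open>X0\<close>; the isometry is the one that takes the
axes to \<open>f\<close>.
\<close>

lemma frame_i_isomorphic:
  assumes C: "clinear C"
    and orth: "orthonormal_on UNIV f"
    and Cf: "\<And>k. C (f k) = - weight v k *s f (partner k)"
    and X: "X = (1 / 2) *s f (\<sigma> (None, True)) + (\<i> / 2) *s f (\<sigma> (None, False))"
  shows "i_isomorphic (std v) (dext C X)"
proof -
  define \<phi> where "\<phi> = frame_map f"
  note \<phi>_apply = frame_map_def[of f, folded \<phi>_def]
  have lin: "clinear \<phi>"
    by (simp add: \<phi>_def clinear_frame_map)
  have "cf (\<phi> x) (\<phi> y) = cf x y" for x y
    by (simp add: \<phi>_def frame_map_isometry[OF orth])
  moreover have "\<phi> (rot v x) = C (\<phi> x)" for x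
  proof -
    have "C (\<phi> x) = (\<Sum>k\<in>UNIV. x $ k *s (- weight v k *s f (partner k)))"
      by (simp add: \<phi>_apply clinear_sum[OF C] clinear_simps[OF C] Cf)
    also have "\<dots> = (\<Sum>k\<in>UNIV. x $ partner k *s (weight v k *s f k))"
      by (subst sum_partner[symmetric]) simp
    finally show ?thesis
      by (simp add: \<phi>_apply mult.commute)
  qed
  moreover have "\<phi> X0 = X"
    by (simp add: X0_def X clinear_simps[OF lin] \<phi>_def[symmetric]
        frame_map_axis[of f, folded \<phi>_def])
  ultimately show ?thesis
    unfolding i_isomorphic_def std_def using dext_i_isomorphism[OF lin] by blast
qed

definition block :: "'p set \<Rightarrow> 'm set" where
  "block J = \<sigma> ` (insert None (Some ` J) \<times> UNIV)"

lemma block_insert: "block (insert j J) = {\<sigma> (Some j, True), \<sigma> (Some j, False)} \<union> block J"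
  by (auto simp: block_def image_iff)

lemma block_empty: "block {} = {\<sigma> (None, True), \<sigma> (None, False)}"
  by (auto simp: block_def image_iff)

lemma block_UNIV: "block UNIV = range \<sigma>"
  by (simp add: block_def flip: UNIV_option_conv)

lemma card_block: "card (block J) = 2 * card J + 2"
  unfolding block_def using inj
  by (subst card_image) (auto simp: card_cartesian_product card_insert_if card_image inj_on_def)

lemma partner_block: "k \<in> block J \<Longrightarrow> partner k \<in> block J"
  by (auto simp: block_def)

text \<open>
Adapted orthonormal families for the hyperbolic plane and the planes in \<open>J\<close>, found by adding one
plane at a time.
\<close>

lemma exists_partial_frame:
  assumes C: "skew C" and span: "spanned_by_eigenvectors C"
    and CX: "C X = 0" "C Y = 0" and XY: "cf X X = 0" "cf Y Y = 0" "cf X Y = 1"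
  shows "\<exists>f v. orthonormal_on (block J) f \<and>
    (\<forall>k\<in>block J. C (f k) = - weight v k *s f (partner k)) \<and>
    X = (1 / 2) *s f (\<sigma> (None, True)) + (\<i> / 2) *s f (\<sigma> (None, False))"
proof (induction J rule: finite_induct[OF finite])
  case 1
  \<comment> \<open>The orthonormal basis of the hyperbolic plane with \<open>X = (E + \<i> F) / 2\<close> and \<open>Y = E - \<i> F\<close>.\<close>
  let ?E = "X + (1 / 2) *s Y" and ?F = "(- \<i>) *s (X - (1 / 2) *s Y)"
  let ?f = "\<lambda>k. if k = \<sigma> (None, True) then ?E else ?F"
  note lin = clinear_simps[OF skew_clinear[OF C]]
  have YX: "cf Y X = 1"
    using XY by (simp add: cf_commute)
  have "orthonormal_on (block {}) ?f"
    by (auto simp: block_empty orthonormal_on_def cf_simps XY YX)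
  moreover have "\<forall>k\<in>block {}. C (?f k) = - weight 0 k *s ?f (partner k)"
    by (auto simp: block_empty lin CX)
  moreover have "X = (1 / 2) *s ?f (\<sigma> (None, True)) + (\<i> / 2) *s ?f (\<sigma> (None, False))"
    by (simp add: vec_eq_iff field_simps)
  ultimately show ?case
    by blast
next
  case (2 j J)
  then obtain f v where f: "orthonormal_on (block J) f"
    and Cf: "\<And>k. k \<in> block J \<Longrightarrow> C (f k) = - weight v k *s f (partner k)"
    and X: "X = (1 / 2) *s f (\<sigma> (None, True)) + (\<i> / 2) *s f (\<sigma> (None, False))"
    by blast
  have "card (insert j J) \<le> CARD('p)"
    by (rule card_mono) auto
  moreover have "2 * CARD('p) + 2 \<le> CARD('m)"
    using card_mono[of UNIV "block UNIV"] by (simp add: card_block)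
  ultimately have card: "card (block J) + 2 \<le> CARD('m)"
    using 2 by (simp add: card_block)
  have "\<exists>c. \<exists>l\<in>block J. C (f k) = c *s f l" if "k \<in> block J" for k
    using Cf[OF that] partner_block[OF that] by blast
  from exists_rotation_pair[OF f C this span card]
  obtain E F a where EF: "cf E E = 1" "cf F F = 1" "cf E F = 0"
    and ES: "\<And>k. k \<in> block J \<Longrightarrow> cf E (f k) = 0" and FS: "\<And>k. k \<in> block J \<Longrightarrow> cf F (f k) = 0"
    and CE: "C E = (\<i> * a) *s F" and CF: "C F = (- \<i> * a) *s E"
    by blast
  let ?f = "f(\<sigma> (Some j, True) := E, \<sigma> (Some j, False) := F)"
  let ?v = "\<chi> l. if l = j then a else v $ l"
  have new: "\<sigma> (Some j, b) \<notin> block J" for b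
    using \<open>j \<notin> J\<close> by (auto simp: block_def)
  have old: "?f k = f k" if "k \<in> block J" for k
    using that new by auto
  have "orthonormal_on (block (insert j J)) ?f"
    using f EF cf_commute[of F E] ES FS cf_commute[of "f _" E] cf_commute[of "f _" F] new
    unfolding orthonormal_on_def block_insert by auto
  moreover have "C (?f k) = - weight ?v k *s ?f (partner k)" if k: "k \<in> block (insert j J)" for k
  proof (cases "k \<in> block J")
    case True
    have "weight ?v k = weight v k"
      using True new by (cases k rule: label_cases) auto
    then show ?thesis
      using Cf[OF True] old[OF True] old[OF partner_block[OF True]] by simp
  next
    case False
    then have "k = \<sigma> (Some j, True) \<or> k = \<sigma> (Some j, False)"
      using k by (auto simp: block_insert)
    then show ?thesis
      by (auto simp: CE CF)
  qed
  moreover have "X = (1 / 2) *s ?f (\<sigma> (None, True)) + (\<i> / 2) *s ?f (\<sigma> (None, False))"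
    using X by simp
  ultimately show ?case
    by blast
qed

text \<open>
An unlabelled coordinate receives a unit vector \<open>e\<close> orthogonal to all planes. Its image is
orthogonal to the planes because they are stable, and to \<open>e\<close> itself by skewness; so it is zero.
\<close>

lemma diagonalizable_i_isomorphic_std:
  assumes C: "skew C" and span: "spanned_by_eigenvectors C"
    and CX: "C X = 0" "C Y = 0" and XY: "cf X X = 0" "cf Y Y = 0" "cf X Y = 1"
  shows "\<exists>v. i_isomorphic (std v) (dext C X)"
proof -
  obtain f v where f: "orthonormal_on (range \<sigma>) f"
    and Cf: "\<And>k. k \<in> range \<sigma> \<Longrightarrow> C (f k) = - weight v k *s f (partner k)"
    and X: "X = (1 / 2) *s f (\<sigma> (None, True)) + (\<i> / 2) *s f (\<sigma> (None, False))"
    using exists_partial_frame[OF assms, of UNIV] unfolding block_UNIV by blast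
  have partner_range: "partner k \<in> range \<sigma>" if "k \<in> range \<sigma>" for k
    using that by auto
  show ?thesis
  proof (cases "range \<sigma> = UNIV")
    case True
    then show ?thesis
      using frame_i_isomorphic[OF skew_clinear[OF C], of f v X] f Cf X by auto
  next
    case False
    then obtain z where z: "z \<notin> range \<sigma>"
      by blast
    have card_range: "card (range \<sigma>) = 2 * CARD('p) + 2"
      using card_block[of UNIV] by (simp add: block_UNIV)
    have "card (insert z (range \<sigma>)) = CARD('m)"
      using card_le card_range z card_mono[of UNIV "insert z (range \<sigma>)"] by simp
    then have UNIV: "insert z (range \<sigma>) = UNIV"
      by (intro card_subset_eq) auto
    have "card (range \<sigma>) < CARD('m)"
      using False by (intro psubset_card_mono) auto
    then obtain e where e: "cf e e = 1" "\<And>k. k \<in> range \<sigma> \<Longrightarrow> cf e (f k) = 0"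
      using exists_unit_vector[OF f] by blast
    let ?f = "f(z := e)"
    have old: "?f k = f k" if "k \<in> range \<sigma>" for k
      using that z by auto
    have orth: "orthonormal_on UNIV ?f"
      using f e cf_commute[of "f _" e] z unfolding orthonormal_on_def UNIV[symmetric] by auto
    have "cf (C e) (?f k) = 0" for k
    proof (cases "k = z")
      case True
      then show ?thesis
        using skew_cf_self[OF C] by simp
    next
      case False
      then have k: "k \<in> range \<sigma>"
        using UNIV by blast
      show ?thesis
        by (simp only: old[OF k] skew_cf[OF C] Cf[OF k] cf_scale_right
            e(2)[OF partner_range[OF k]]) simp
    qed
    then have Ce: "C e = 0"
      using orthonormal_complete[OF orth] by blast
    have "C (?f k) = - weight v k *s ?f (partner k)" for k
    proof (cases "k = z")
      case True
      then show ?thesis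
        using z Ce by simp
    next
      case False
      then have k: "k \<in> range \<sigma>"
        using UNIV by blast
      show ?thesis
        using Cf[OF k] old[OF k] old[OF partner_range[OF k]] by simp
    qed
    moreover have "X = (1 / 2) *s ?f (\<sigma> (None, True)) + (\<i> / 2) *s ?f (\<sigma> (None, False))"
      using X by (simp only: old[OF rangeI])
    ultimately show ?thesis
      using frame_i_isomorphic[OF skew_clinear[OF C] orth] by blast
  qed
qed

section \<open>Every diagonalizable structure is standard\<close>

text \<open>
Each axis is the mean of the two eigenvectors $e_k \pm i e_{k'}$, where $k'$ is the partner of $k$.
\<close>

lemma rot_spanned: "spanned_by_eigenvectors (rot v)"
proof -
  let ?E = "{x. \<exists>c. rot v x = c *s x}"
  have axis: "axis k 1 \<in> vec.span ?E" for k
  proof -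
    let ?u = "axis k 1 + \<i> *s axis (partner k) 1" and ?w = "axis k 1 - \<i> *s axis (partner k) 1"
    have u: "rot v ?u = (\<i> * weight v k) *s ?u" and w: "rot v ?w = (- \<i> * weight v k) *s ?w"
      by (simp_all add: rot_simps rot_axis vec_eq_iff algebra_simps)
    have "?u \<in> vec.span ?E" and "?w \<in> vec.span ?E"
      by (rule vec.span_base, rule CollectI, rule exI, rule u)
        (rule vec.span_base, rule CollectI, rule exI, rule w)
    then have "(1 / 2) *s (?u + ?w) \<in> vec.span ?E"
      by (rule vec.span_scale[OF vec.span_add])
    moreover have "(1 / 2) *s (?u + ?w) = axis k 1"
      by (simp add: vec_eq_iff)
    ultimately show ?thesis
      by simp
  qed
  have "x \<in> vec.span ?E" for x
  proof -
    have "(\<Sum>k\<in>UNIV. x $ k *s axis k 1) \<in> vec.span ?E"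
      by (intro vec.span_sum vec.span_scale axis)
    then show ?thesis
      by (simp only: basis_expansion)
  qed
  then show ?thesis
    by (auto simp: spanned_by_eigenvectors_def)
qed

lemma std_in_diag_structures:
  assumes "v \<in> Lambda"
  shows "std v \<in> diag_structures"
proof -
  obtain j where "v $ j \<noteq> 0"
    using assms by (auto simp: Lambda_def)
  then have "rot v (axis (\<sigma> (Some j, True)) 1) $ \<sigma> (Some j, False) \<noteq> 0"
    by (simp add: axis_def)
  then have "rot v (axis (\<sigma> (Some j, True)) 1) \<noteq> 0"
    by (metis zero_index)
  then show ?thesis
    unfolding std_def
    by (rule dext_in_diag_structures[OF skew_rot rot_spanned rot_X0 rot_Y0 hyperbolic_X0_Y0])
qed

lemma diag_structure_i_isomorphic_std:
  assumes br: "br \<in> diag_structures"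
  shows "\<exists>v\<in>Lambda. i_isomorphic (std v) br"
proof -
  obtain v where v: "i_isomorphic (std v) br"
    using diag_structure_dext[OF br] diagonalizable_i_isomorphic_std by metis
  have "v \<in> Lambda"
  proof (rule ccontr)
    assume "v \<notin> Lambda"
    then have "v = 0"
      by (simp add: Lambda_def vec_eq_iff)
    have "weight 0 k = 0" for k
      using weight_scale[of 0 0 k] by simp
    then have "rot 0 x = 0" for x
      by (simp add: vec_eq_iff)
    then have zero: "std v x y = 0" for x y
      by (simp add: \<open>v = 0\<close> std_def dext_def cf_simps)
    obtain \<phi> where \<phi>: "clinear \<phi>" "surj \<phi>" "\<And>x y. \<phi> (std v x y) = br (\<phi> x) (\<phi> y)"
      using v by (auto simp: i_isomorphic_def i_isomorphism_def lie_isomorphism_def bij_def)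
    have "br (\<phi> x) (\<phi> y) = 0" for x y
      using \<phi>(3)[of x y] by (simp add: zero clinear_simps[OF \<phi>(1)])
    then have "abelian_bracket br"
      unfolding abelian_bracket_def using \<phi>(2) by (metis surjD)
    then show False
      using br by (simp add: diag_structures_def diagonalizable_singular_def singular_quadratic_def)
  qed
  then show ?thesis
    using v by blast
qed

section \<open>Invariance under the group\<close>

lemma label_cases_signed [case_names NoneT NoneF SomeT SomeF free]:
  obtains "k = \<sigma> (None, True)" | "k = \<sigma> (None, False)"
    | j where "k = \<sigma> (Some j, True)" | j where "k = \<sigma> (Some j, False)" | "k \<notin> range \<sigma>"
  by (cases k rule: label_cases) (metis (full_types))+

text \<open>
A scalar can be moved from the map to the isotropic vector.
\<close>

lemma std_scale: "std (c *s v) = dext (rot v) (c *s X0)"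
proof (intro ext)
  fix x y
  have "rot (c *s v) z = c *s rot v z" for z
    by (simp add: vec_eq_iff weight_scale)
  then show "std (c *s v) x y = dext (rot v) (c *s X0) x y"
    by (simp add: std_def dext_def cf_simps mult.commute)
qed

text \<open>
The hyperbolic rotation \<open>X0 \<mapsto> c *s X0\<close>, \<open>Y0 \<mapsto> (1 / c) *s Y0\<close> is an isometry that commutes with
the standard map.
\<close>

lemma std_scale_i_isomorphic:
  assumes "c \<noteq> 0"
  shows "i_isomorphic (std v) (std (c *s v))"
proof -
  let ?X = "c *s X0" and ?Y = "(1 / c) *s Y0"
  \<comment> \<open>The orthonormal basis of the hyperbolic plane in which \<open>?X\<close> has the coordinates of \<open>X0\<close>.\<close>
  define E F where "E = ?X + (1 / 2) *s ?Y" and "F = (- \<i>) *s (?X - (1 / 2) *s ?Y)"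
  let ?f = "\<lambda>k. if k = \<sigma> (None, True) then E else if k = \<sigma> (None, False) then F else axis k 1"
  have YX: "cf Y0 X0 = 1"
    using hyperbolic_X0_Y0(3) by (simp add: cf_commute)
  have plane: "cf E E = 1" "cf F F = 1" "cf E F = 0" "cf F E = 0"
    using assms by (simp_all add: E_def F_def cf_simps hyperbolic_X0_Y0 YX)
  have kernel: "rot v E = 0" "rot v F = 0"
    by (simp_all add: E_def F_def rot_simps rot_X0 rot_Y0)
  have perp: "cf E (axis k 1) = 0" "cf F (axis k 1) = 0" "cf (axis k 1) E = 0" "cf (axis k 1) F = 0"
    if "k \<noteq> \<sigma> (None, True)" "k \<noteq> \<sigma> (None, False)" for k
  proof -
    have "X0 $ k = 0" "Y0 $ k = 0"
      using that by (cases k rule: label_cases_signed; simp add: X0_nth Y0_nth)+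
    then show "cf E (axis k 1) = 0" "cf F (axis k 1) = 0"
      "cf (axis k 1) E = 0" "cf (axis k 1) F = 0"
      by (simp_all add: cf_axis_right cf_axis_left E_def F_def)
  qed
  have "orthonormal_on UNIV ?f"
    unfolding orthonormal_on_def by (auto simp: plane perp cf_axis_axis)
  moreover have "rot v (?f k) = - weight v k *s ?f (partner k)" for k
    by (cases k rule: label_cases_signed) (auto simp: kernel rot_axis)
  moreover have "?X = (1 / 2) *s ?f (\<sigma> (None, True)) + (\<i> / 2) *s ?f (\<sigma> (None, False))"
    by (simp add: E_def F_def vec_eq_iff field_simps)
  ultimately show ?thesis
    unfolding std_scale by (rule frame_i_isomorphic[OF skew_clinear[OF skew_rot]])
qed

text \<open>
Moves the planes according to \<open>\<pi>\<close> and fixes all other coordinates.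
\<close>

definition relabel :: "('p \<Rightarrow> 'p) \<Rightarrow> 'm \<Rightarrow> 'm" where
  "relabel \<pi> k = (if k \<in> range \<sigma> then \<sigma> (apfst (map_option \<pi>) (inv_into UNIV \<sigma> k)) else k)"

lemma relabel_simps [simp]:
  "relabel \<pi> (\<sigma> (None, b)) = \<sigma> (None, b)"
  "relabel \<pi> (\<sigma> (Some j, b)) = \<sigma> (Some (\<pi> j), b)"
  "k \<notin> range \<sigma> \<Longrightarrow> relabel \<pi> k = k"
  by (simp_all add: relabel_def inj)

text \<open>
Reversing one axis of a plane reverses the sense of its rotation, that is, the sign of its
parameter.
\<close>

lemma std_signed_permutation_i_isomorphic:
  assumes \<pi>: "bij \<pi>" and s: "\<And>j. s j = 1 \<or> s j = - 1"
  shows "i_isomorphic (std (\<chi> j. s j * v $ \<pi> j)) (std v)"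
proof -
  let ?v = "\<chi> j. s j * v $ \<pi> j"
  have ss: "s j * s j = 1" for j
    using s[of j] by auto
  have relabel_inj: "relabel \<pi> k = relabel \<pi> l \<Longrightarrow> k = l" for k l
    using bij_is_inj[OF \<pi>, THEN injD]
    by (cases k rule: label_cases; cases l rule: label_cases) auto
  define \<epsilon> where
    "\<epsilon> k = (if \<exists>j. k = \<sigma> (Some j, False) then s (THE j. k = \<sigma> (Some j, False)) else 1)" for k
  have \<epsilon>_simps [simp]: "\<epsilon> (\<sigma> (None, b)) = 1" "\<epsilon> (\<sigma> (Some j, True)) = 1"
    "\<epsilon> (\<sigma> (Some j, False)) = s j" "k \<notin> range \<sigma> \<Longrightarrow> \<epsilon> k = 1" for b j k
    by (auto simp: \<epsilon>_def)
  have \<epsilon>: "\<epsilon> k * \<epsilon> k = 1" for k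
    by (cases k rule: label_cases_signed) (auto simp: ss)
  let ?f = "\<lambda>k. \<epsilon> k *s axis (relabel \<pi> k) 1"
  have partner_relabel: "partner (relabel \<pi> k) = relabel \<pi> (partner k)" for k
    by (cases k rule: label_cases) auto
  have weight_relabel: "\<epsilon> k * weight v (relabel \<pi> k) = weight ?v k * \<epsilon> (partner k)" for k
  proof (cases k rule: label_cases_signed)
    case (SomeT j)
    then show ?thesis
      using s[of j] by auto
  qed auto
  have "orthonormal_on UNIV ?f"
    unfolding orthonormal_on_def by (auto simp: cf_simps cf_axis_axis \<epsilon> dest: relabel_inj)
  moreover have "rot v (?f k) = - weight ?v k *s ?f (partner k)" for k
    using weight_relabel[of k] by (simp add: rot_simps rot_axis partner_relabel)
  moreover have "X0 = (1 / 2) *s ?f (\<sigma> (None, True)) + (\<i> / 2) *s ?f (\<sigma> (None, False))"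
    by (simp add: X0_def)
  ultimately show ?thesis
    unfolding std_def[of v] by (rule frame_i_isomorphic[OF skew_clinear[OF skew_rot]])
qed

lemma H_group_i_isomorphic:
  assumes "h \<in> H_group"
  shows "i_isomorphic (std v) (std (h v))"
proof -
  have gen: "i_isomorphic (std v) (std (h v))" if h: "h \<in> H_generators" for h v
  proof -
    consider \<pi> where "bij \<pi>" "h = (\<lambda>v. \<chi> i. v $ \<pi> i)"
      | s where "\<And>i. s i = 1 \<or> s i = (- 1 :: complex)" "h = (\<lambda>v. \<chi> i. s i * v $ i)"
      | c where "c \<noteq> 0" "h = (\<lambda>v. c *s v)"
      using h unfolding H_generators_def by blast
    then show ?thesis
    proof cases
      case (1 \<pi>)
      have "i_isomorphic (std (\<chi> j. 1 * v $ \<pi> j)) (std v)"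
        by (rule std_signed_permutation_i_isomorphic[OF 1(1)]) simp
      then show ?thesis
        unfolding 1(2) mult_1 by (rule i_isomorphic_sym)
    next
      case (2 s)
      have "i_isomorphic (std (\<chi> j. s j * v $ id j)) (std v)"
        by (rule std_signed_permutation_i_isomorphic[OF bij_id 2(1)])
      then show ?thesis
        unfolding 2(2) id_apply by (rule i_isomorphic_sym)
    next
      case (3 c)
      then show ?thesis
        by (simp add: std_scale_i_isomorphic)
    qed
  qed
  have "\<forall>v. i_isomorphic (std v) (std (h v))"
  proof (rule H_group_induct[OF assms, where P = "\<lambda>h. \<forall>v. i_isomorphic (std v) (std (h v))"])
    show "\<forall>v. i_isomorphic (std v) (std (id v))"
      by (simp add: i_isomorphic_refl)
    show "\<forall>v. i_isomorphic (std v) (std (h v))" if "h \<in> H_generators" for h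
      using gen[OF that] by blast
    show "\<forall>v. i_isomorphic (std v) (std (g v))" if h: "h \<in> H_generators" and hg: "h \<circ> g = id" for g h
    proof
      fix v
      have "h (g v) = v"
        using fun_cong[OF hg, of v] by simp
      then have "i_isomorphic (std (g v)) (std v)"
        using gen[OF h, of "g v"] by (simp only:)
      then show "i_isomorphic (std v) (std (g v))"
        by (rule i_isomorphic_sym)
    qed
    show "\<forall>v. i_isomorphic (std v) (std ((g \<circ> h) v))"
      if "\<forall>v. i_isomorphic (std v) (std (g v))" "\<forall>v. i_isomorphic (std v) (std (h v))" for g h
    proof
      fix v
      show "i_isomorphic (std v) (std ((g \<circ> h) v))"
        using i_isomorphic_trans[OF that(2)[rule_format, of v] that(1)[rule_format, of "h v"]]
        by (simp only: comp_apply)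
    qed
  qed
  then show ?thesis ..
qed

section \<open>Reduced structures\<close>

lemma std_reduced_imp:
  assumes "reduced_quadratic (std v) cf"
  shows "range \<sigma> = UNIV" "v \<in> Lambda_plus"
proof -
  have iso: "cf x x = 0" if "x \<in> lie_center (std v)" for x
    using assms that by (simp add: reduced_quadratic_def)
  have not_central: "axis k 1 \<notin> lie_center (std v)" for k
    using iso[of "axis k 1"] by (auto simp: cf_axis_right)
  have central: "axis k 1 \<in> lie_center (std v)" if "weight v k = 0" "X0 $ k = 0" for k
    using that by (simp add: lie_center_def std_def dext_def cf_axis_right rot_axis cf_simps)
  show "range \<sigma> = UNIV"
    using central not_central by (metis UNIV_eq_I X0_nth(4) weight_simps(3))
  show "v \<in> Lambda_plus"
    unfolding Lambda_plus_def
    using central[of "\<sigma> (Some _, True)"] not_central X0_nth(3) by fastforce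
qed

text \<open>
A central vector is orthogonal to \<open>X0\<close> and, all parameters being non-zero, has no component in the
planes. So it lies in the intersection of the hyperbolic plane with the orthogonal complement of
\<open>X0\<close>, which is the isotropic line of \<open>X0\<close>.
\<close>

lemma std_reduced:
  assumes full: "range \<sigma> = UNIV" and v: "v \<in> Lambda_plus"
  shows "reduced_quadratic (std v) cf"
proof -
  have center: "x $ \<sigma> (Some j, b) = 0" "cf X0 x = 0" if x: "x \<in> lie_center (std v)" for x j b
  proof -
    have zero: "cf X0 x *s rot v y - cf X0 y *s rot v x + cf (rot v x) y *s X0 = 0" for y
      using x by (simp add: lie_center_def std_def dext_def)
    have vj: "v $ j \<noteq> 0" for j
      using v by (simp add: Lambda_plus_def)
    \<comment> \<open>Bracketing with a vector orthogonal to \<open>X0\<close> and not killed by the map excludes \<open>Y0\<close>.\<close>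
    let ?y = "axis (\<sigma> (Some j, True)) 1"
    have "(cf X0 x *s rot v ?y - cf X0 ?y *s rot v x + cf (rot v x) ?y *s X0) $ \<sigma> (Some j, False) = 0"
      by (simp only: zero zero_index)
    moreover have "cf X0 ?y = 0"
      by (simp add: cf_axis_right X0_nth)
    moreover have "rot v ?y $ \<sigma> (Some j, False) = \<i> * v $ j"
      by (simp add: axis_def)
    ultimately show "cf X0 x = 0"
      using vj[of j] by (simp add: X0_nth)
    then have "rot v x = cf (rot v x) Y0 *s X0"
      using zero[of Y0] by (simp add: hyperbolic_X0_Y0)
    moreover have "cf (rot v x) Y0 = 0"
      by (simp add: skew_cf[OF skew_rot] rot_Y0 cf_simps)
    ultimately have "rot v x $ \<sigma> (Some j, \<not> b) = 0"
      by simp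
    then show "x $ \<sigma> (Some j, b) = 0"
      using vj[of j] by (cases b) auto
  qed
  have "cf x y = 0" if x: "x \<in> lie_center (std v)" and y: "y \<in> lie_center (std v)" for x y
  proof -
    let ?T = "\<sigma> (None, True)" and ?F = "\<sigma> (None, False)"
    have "x $ k * y $ k = 0" if "k \<notin> {?T, ?F}" for k
      using that center(1)[OF x] full by (cases k rule: label_cases_signed) auto
    then have "cf x y = (\<Sum>k\<in>{?T, ?F}. x $ k * y $ k)"
      unfolding canonical_form_def by (intro sum.mono_neutral_right) auto
    moreover have "x $ ?T = - \<i> * x $ ?F" "y $ ?T = - \<i> * y $ ?F"
      using center(2)[OF x] center(2)[OF y] by (simp_all add: cf_X0 eq_neg_iff_add_eq_0)
    ultimately show ?thesis
      by (simp add: algebra_simps)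
  qed
  moreover have "(UNIV :: (complex ^ 'm) set) \<noteq> {0}"
  proof
    assume "(UNIV :: (complex ^ 'm) set) = {0}"
    then have "Y0 = 0"
      by blast
    then show False
      using hyperbolic_X0_Y0(3) by (simp add: cf_zero_right)
  qed
  ultimately show ?thesis
    using std_quadratic by (simp add: reduced_quadratic_def)
qed

end

section \<open>Eigenvalue multiplicities of adjoint maps\<close>

definition adjoint_eigenspace ::
  "(complex ^ 'm \<Rightarrow> complex ^ 'm \<Rightarrow> complex ^ 'm) \<Rightarrow> complex ^ 'm \<Rightarrow> complex \<Rightarrow>
   (complex ^ 'm) set" where
  "adjoint_eigenspace br x c = {y. br x y = c *s y}"

lemma lie_isomorphism_dim_eigenspace:
  assumes "lie_isomorphism br br' \<phi>"
  shows "vec.dim (adjoint_eigenspace br' (\<phi> x) c) = vec.dim (adjoint_eigenspace br x c)"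
proof -
  have lin: "clinear \<phi>" and bij: "bij \<phi>" and hom: "\<And>x y. \<phi> (br x y) = br' (\<phi> x) (\<phi> y)"
    using assms by (auto simp: lie_isomorphism_def)
  have "adjoint_eigenspace br' (\<phi> x) c = \<phi> ` adjoint_eigenspace br x c"
  proof (intro equalityI subsetI)
    fix y' assume y': "y' \<in> adjoint_eigenspace br' (\<phi> x) c"
    obtain y where y: "y' = \<phi> y"
      using bij by (meson bij_pointE)
    have "\<phi> (br x y) = \<phi> (c *s y)"
      using y' by (simp add: y adjoint_eigenspace_def hom clinear_simps[OF lin])
    then have "br x y = c *s y"
      using bij_is_inj[OF bij] by (rule injD[rotated])
    then show "y' \<in> \<phi> ` adjoint_eigenspace br x c"
      by (auto simp: y adjoint_eigenspace_def)
  next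
    fix y' assume "y' \<in> \<phi> ` adjoint_eigenspace br x c"
    then obtain y where y: "y' = \<phi> y" "br x y = c *s y"
      by (auto simp: adjoint_eigenspace_def)
    have "br' (\<phi> x) (\<phi> y) = \<phi> (c *s y)"
      unfolding hom[symmetric] y(2) ..
    then show "y' \<in> adjoint_eigenspace br' (\<phi> x) c"
      by (simp add: adjoint_eigenspace_def y(1) clinear_simps[OF lin])
  qed
  also have "vec.dim \<dots> = vec.dim (adjoint_eigenspace br x c)"
    using lin bij_is_inj[OF bij] by (intro vec.dim_image_eq) (auto simp: clinear_def intro: inj_on_subset)
  finally show ?thesis .
qed

text \<open>
The fibre over zero is covered too, since all fibres together have as many elements as the index
type.
\<close>

lemma permutation_of_equal_fibres:
  fixes a b :: "'p::finite \<Rightarrow> 'b::zero"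
  assumes "\<And>d. d \<noteq> 0 \<Longrightarrow> card {j. a j = d} = card {j. b j = d}"
  obtains \<pi> where "bij \<pi>" "\<And>j. a j = b (\<pi> j)"
proof -
  let ?M = "\<lambda>f :: 'p \<Rightarrow> 'b. image_mset f (mset_set UNIV)"
  have count: "count (?M f) d = card {j. f j = d}" for f d
    by (simp add: count_image_mset vimage_def)
  \<comment> \<open>Both multisets of values have the same size and agree away from \<open>0\<close>, hence also at \<open>0\<close>.\<close>
  have off_zero: "filter_mset (\<lambda>d. d \<noteq> 0) (?M a) = filter_mset (\<lambda>d. d \<noteq> 0) (?M b)"
    using assms by (intro multiset_eqI) (simp add: count)
  have "size (?M f) = size (filter_mset (\<lambda>d. d \<noteq> 0) (?M f)) + count (?M f) 0" for f
  proof -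
    have "size (?M f) = size (filter_mset (\<lambda>d. d \<noteq> 0) (?M f) + filter_mset (\<lambda>d. \<not> d \<noteq> 0) (?M f))"
      by (simp only: multiset_partition[symmetric])
    moreover have "filter_mset (\<lambda>d. \<not> d \<noteq> 0) (?M f) = replicate_mset (count (?M f) 0) 0"
      using filter_eq_replicate_mset[of 0 "?M f"] by (simp add: eq_commute)
    ultimately show ?thesis
      by (simp only: size_union size_replicate_mset)
  qed
  from this[of a] this[of b] have "count (?M a) 0 = count (?M b) 0"
    unfolding off_zero by simp
  then have "?M a = ?M b"
    using assms by (intro multiset_eqI) (metis count)
  then obtain \<pi> where "\<pi> permutes UNIV" "\<And>j. a j = b (\<pi> j)"
    using image_mset_eq_implies_permutes[of UNIV a b] by auto
  then show ?thesis
    using that permutes_bij by blast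
qed

context paired_coordinates
begin

text \<open>
For $c \neq 0$, applying \<open>cf X0\<close> to $[x, y] = c y$ shows that \<open>y\<close> is orthogonal to \<open>X0\<close>, so the equation
reads $m C y + B(C x, y) X_0 = c y$. Its solutions differ from those of $m C y = c y$ only by a
multiple of \<open>X0\<close> that depends linearly on \<open>y\<close>. In each plane with $(m v_j)^2 = c^2$ a solution of
the latter is determined by its first coordinate, which is arbitrary, and in all others it vanishes.
The map \<open>G\<close> reconstructs \<open>y\<close> from these first coordinates.
\<close>

lemma dim_adjoint_eigenspace:
  assumes c: "c \<noteq> 0"
  shows "vec.dim (adjoint_eigenspace (std v) x c) = card {j. (cf X0 x * v $ j)\<^sup>2 = c\<^sup>2}"
proof -
  define m where "m = cf X0 x"
  define D where "D = (\<lambda>j. \<sigma> (Some j, True)) ` {j. (m * v $ j)\<^sup>2 = c\<^sup>2}"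
  define Z where "Z = {z :: complex ^ 'm. \<forall>k. k \<notin> D \<longrightarrow> z $ k = 0}"
  \<comment> \<open>\<open>Z\<close> consists of the admissible first coordinates, \<open>G0\<close> completes them to an eigenvector of
    the multiple of the standard map, and \<open>G\<close> adds the multiple of \<open>X0\<close>.\<close>
  define G0 where "G0 z = z + (m / c) *s rot v z" for z
  define G where "G z = G0 z + (cf (rot v x) (G0 z) / c) *s X0" for z
  have X0_rot: "cf X0 (rot v z) = 0" "cf (rot v z) X0 = 0" for z
    using skew_cf_kernel[OF skew_rot rot_X0] cf_commute by metis+
  have G0_lin: "clinear G0"
    by (simp add: clinear_iff G0_def rot_simps vec_eq_iff algebra_simps)
  have G_lin: "clinear G"
    by (simp add: clinear_iff G_def clinear_simps[OF G0_lin] cf_simps vec_eq_iff algebra_simps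
        add_divide_distrib)
  have G_nth: "G z $ \<sigma> (Some j, True) = z $ \<sigma> (Some j, True)" if "z \<in> Z" for z j
  proof -
    have "\<sigma> (Some j, False) \<notin> D"
      by (auto simp: D_def)
    then show ?thesis
      using that by (simp add: G_def G0_def Z_def X0_nth)
  qed
  have Z_sub: "vec.subspace Z"
    by (auto simp: Z_def vec.subspace_def)
  have "inj_on G Z"
  proof (rule inj_onI)
    fix z z' assume z: "z \<in> Z" "z' \<in> Z" and "G z = G z'"
    have "z $ k = z' $ k" for k
    proof (cases "k \<in> D")
      case True
      then obtain j where "k = \<sigma> (Some j, True)"
        by (auto simp: D_def)
      then show ?thesis
        using G_nth[OF z(1), of j] G_nth[OF z(2), of j] \<open>G z = G z'\<close> by simp
    next
      case False
      then show ?thesis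
        using z by (simp add: Z_def)
    qed
    then show "z = z'"
      by (simp add: vec_eq_iff)
  qed
  moreover have "vec.span Z = Z"
    using Z_sub by (simp only: vec.span_eq_iff)
  ultimately have "inj_on G (vec.span Z)"
    by (simp only:)
  then have "vec.dim (G ` Z) = vec.dim Z"
    using G_lin by (intro vec.dim_image_eq) (simp_all add: clinear_def)
  also have "\<dots> = card D"
    unfolding Z_def by (rule dim_substandard_cart)
  also have "\<dots> = card {j. (m * v $ j)\<^sup>2 = c\<^sup>2}"
    unfolding D_def by (rule card_image) (auto simp: inj_on_def)
  also have "G ` Z = adjoint_eigenspace (std v) x c"
  proof (intro equalityI subsetI)
    fix y assume "y \<in> G ` Z"
    then obtain z where z: "z \<in> Z" and y: "y = G z"
      by blast
    have eig: "m *s rot v (G0 z) = c *s G0 z"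
    proof -
      have "c * (c * z $ k) + m * (m * (z $ k * (weight v k * weight v k))) = 0" for k
      proof (cases "k \<in> D")
        case True
        then obtain j where "k = \<sigma> (Some j, True)" "(m * v $ j)\<^sup>2 = c\<^sup>2"
          by (auto simp: D_def)
        then show ?thesis
          by (simp add: power2_eq_square algebra_simps)
      next
        case False
        then show ?thesis
          using z by (simp add: Z_def)
      qed
      then show ?thesis
        using c by (simp add: G0_def vec_eq_iff rot_simps field_simps)
    qed
    have "c * cf X0 (G0 z) = cf X0 (m *s rot v (G0 z))"
      unfolding eig by (simp add: cf_simps)
    then have X0_G0: "cf X0 (G0 z) = 0"
      using c by (simp add: cf_simps X0_rot)
    then have X0_y: "cf X0 y = 0"
      by (simp add: y G_def cf_simps hyperbolic_X0_Y0)
    have "rot v y = rot v (G0 z)"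
      by (simp add: y G_def rot_simps rot_X0)
    moreover have "cf (rot v x) y = cf (rot v x) (G0 z)"
      by (simp add: y G_def cf_simps X0_rot)
    ultimately have "std v x y = m *s rot v (G0 z) + cf (rot v x) (G0 z) *s X0"
      by (simp add: std_def dext_def X0_y m_def)
    also have "\<dots> = c *s y"
      unfolding eig using c by (simp add: y G_def vec.scale_right_distrib)
    finally show "y \<in> adjoint_eigenspace (std v) x c"
      by (simp add: adjoint_eigenspace_def)
  next
    fix y assume "y \<in> adjoint_eigenspace (std v) x c"
    then have y: "m *s rot v y - cf X0 y *s rot v x + cf (rot v x) y *s X0 = c *s y"
      by (simp add: adjoint_eigenspace_def std_def dext_def m_def)
    have "c * cf X0 y = cf X0 (m *s rot v y - cf X0 y *s rot v x + cf (rot v x) y *s X0)"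
      unfolding y by (simp add: cf_simps)
    then have X0_y: "cf X0 y = 0"
      using c by (simp add: cf_simps X0_rot hyperbolic_X0_Y0)
    define y' where "y' = y - (cf (rot v x) y / c) *s X0"
    have y_y': "y = y' + (cf (rot v x) y' / c) *s X0"
      by (simp add: y'_def cf_simps X0_rot)
    have eig: "m *s rot v y' = c *s y'"
    proof -
      have "m *s rot v y' = c *s y - cf (rot v x) y *s X0"
        using y by (simp add: y'_def rot_simps rot_X0 X0_y flip: y)
      then show ?thesis
        using c by (simp add: y'_def vec.scale_right_diff_distrib)
    qed
    have comp: "m * (weight v k * y' $ partner k) = c * y' $ k" for k
      using arg_cong[OF eig, of "\<lambda>z. z $ k"] by simp
    define z where "z = (\<chi> k. if k \<in> D then y' $ k else 0)"
    have "z \<in> Z"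
      by (simp add: z_def Z_def)
    have outside: "y' $ \<sigma> (Some j, True) = 0" if "\<sigma> (Some j, True) \<notin> D" for j
    proof -
      let ?t = "y' $ \<sigma> (Some j, True)" and ?f = "y' $ \<sigma> (Some j, False)"
      have t: "c * ?t = m * (- \<i> * v $ j * ?f)" and f: "c * ?f = m * (\<i> * v $ j * ?t)"
        using comp[of "\<sigma> (Some j, True)"] comp[of "\<sigma> (Some j, False)"] by simp_all
      have "c * (c * ?t) = m * (- \<i> * v $ j * (c * ?f))"
        unfolding t by (simp add: algebra_simps)
      also have "\<dots> = (m * v $ j)\<^sup>2 * ?t"
        unfolding f by (simp add: power2_eq_square algebra_simps)
      finally have "c * (c * ?t) = (m * v $ j)\<^sup>2 * ?t" .
      moreover have "(m * v $ j)\<^sup>2 \<noteq> c\<^sup>2"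
        using that by (auto simp: D_def)
      ultimately show ?thesis
        by (simp add: power2_eq_square flip: mult.assoc)
    qed
    have "y' $ k = G0 z $ k" for k
    proof (cases k rule: label_cases)
      case (None b)
      then show ?thesis
        using comp[of k] c by (simp add: G0_def z_def D_def image_iff)
    next
      case (Some j b)
      have False_D: "\<sigma> (Some j, False) \<notin> D"
        by (auto simp: D_def)
      show ?thesis
      proof (cases b)
        case True
        then show ?thesis
          using outside[of j] False_D Some by (simp add: G0_def z_def)
      next
        case False
        have "z $ \<sigma> (Some j, True) = y' $ \<sigma> (Some j, True)"
          using outside[of j] by (simp add: z_def)
        moreover have "z $ \<sigma> (Some j, False) = 0"
          using False_D by (simp add: z_def)
        ultimately show ?thesis
          using comp[of k] c Some False by (simp add: G0_def field_simps)
      qed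
    next
      case free
      then show ?thesis
        using comp[of k] c by (auto simp: G0_def z_def D_def)
    qed
    then have "y' = G0 z"
      by (simp add: vec_eq_iff)
    then have "y = G z"
      using y_y' by (simp add: G_def)
    then show "y \<in> G ` Z"
      using \<open>z \<in> Z\<close> by blast
  qed
  finally show ?thesis
    by (simp add: m_def)
qed

text \<open>
The eigenspaces of $\mathrm{ad}(Y_0)$ are compared with those of the adjoint map of its image, whose
coefficient along \<open>Y0\<close> is the scaling factor \<open>m\<close>. Equal multiplicities give equality of squares up
to a permutation, hence equality up to signs.
\<close>

lemma lie_isomorphic_std_signed_permutation:
  assumes iso: "lie_isomorphism (std v) (std w) \<phi>" and v: "v \<in> Lambda"
  shows "\<exists>\<pi> s c. bij \<pi> \<and> (\<forall>i. s i = 1 \<or> s i = (- 1 :: complex)) \<and> c \<noteq> 0 \<and>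
    v = (\<chi> i. s i * (c * w $ \<pi> i))"
proof -
  define m where "m = cf X0 (\<phi> Y0)"
  have fibres: "card {j. (v $ j)\<^sup>2 = d} = card {j. (m * w $ j)\<^sup>2 = d}" if "d \<noteq> 0" for d
  proof -
    have "csqrt d \<noteq> 0"
      using that by simp
    have "card {j. (v $ j)\<^sup>2 = d} = vec.dim (adjoint_eigenspace (std v) Y0 (csqrt d))"
      by (simp add: dim_adjoint_eigenspace[OF \<open>csqrt d \<noteq> 0\<close>] hyperbolic_X0_Y0)
    also have "\<dots> = vec.dim (adjoint_eigenspace (std w) (\<phi> Y0) (csqrt d))"
      by (simp add: lie_isomorphism_dim_eigenspace[OF iso])
    also have "\<dots> = card {j. (m * w $ j)\<^sup>2 = d}"
      by (simp add: dim_adjoint_eigenspace[OF \<open>csqrt d \<noteq> 0\<close>] m_def)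
    finally show ?thesis .
  qed
  obtain \<pi> where \<pi>: "bij \<pi>" "\<And>j. (v $ j)\<^sup>2 = (m * w $ \<pi> j)\<^sup>2"
    using permutation_of_equal_fibres[OF fibres] by blast
  define s where "s j = (if v $ j = m * w $ \<pi> j then 1 else - 1 :: complex)" for j
  have "v $ j = s j * (m * w $ \<pi> j)" for j
    using \<pi>(2)[of j] by (auto simp: s_def power2_eq_iff)
  then have "v = (\<chi> i. s i * (m * w $ \<pi> i))"
    by (simp add: vec_eq_iff)
  moreover have "m \<noteq> 0"
    using calculation v by (auto simp: Lambda_def)
  moreover have "\<forall>i. s i = 1 \<or> s i = - 1"
    by (simp add: s_def)
  ultimately show ?thesis
    using \<pi>(1) by blast
qed

end

section \<open>Passing to the quotients\<close>

text \<open>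
A family of representatives that meets every class, and identifies parameters exactly according to
\<open>R\<close>, identifies the quotients.
\<close>

lemma quotient_bij_betw:
  assumes equiv: "equiv S r" and R: "R \<subseteq> T \<times> T"
    and b: "\<And>t. t \<in> T \<Longrightarrow> b t \<in> S"
    and iff: "\<And>t t'. t \<in> T \<Longrightarrow> t' \<in> T \<Longrightarrow> (b t, b t') \<in> r \<longleftrightarrow> (t, t') \<in> R"
    and surj: "\<And>s. s \<in> S \<Longrightarrow> \<exists>t\<in>T. (b t, s) \<in> r"
  shows "\<exists>f. bij_betw f (S // r) (T // R)"
proof -
  have refl: "(s, s) \<in> r" if "s \<in> S" for s
    using equiv that by (simp add: equiv_def refl_on_def)
  have sym: "(s, t) \<in> r \<Longrightarrow> (t, s) \<in> r" for s t
    using equiv by (auto simp: equiv_def sym_def)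
  have trans: "(s, t) \<in> r \<Longrightarrow> (t, u) \<in> r \<Longrightarrow> (s, u) \<in> r" for s t u
    using equiv unfolding equiv_def trans_def by blast
  define g where "g X = r `` (b ` X)" for X
  have g: "g (R `` {t}) = r `` {b t}" if t: "t \<in> T" for t
  proof (intro equalityI subsetI)
    fix s assume "s \<in> g (R `` {t})"
    then obtain t' where "(t, t') \<in> R" "(b t', s) \<in> r"
      by (auto simp: g_def)
    then show "s \<in> r `` {b t}"
      using iff[OF t, of t'] R trans by blast
  next
    fix s assume "s \<in> r `` {b t}"
    moreover have "(t, t) \<in> R"
      using iff[OF t t] refl b[OF t] by blast
    ultimately show "s \<in> g (R `` {t})"
      by (auto simp: g_def)
  qed
  have "bij_betw g (T // R) (S // r)"
  proof (intro bij_betwI')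
    fix X Y assume "X \<in> T // R" "Y \<in> T // R"
    then obtain t t' where t: "t \<in> T" "t' \<in> T" and XY: "X = R `` {t}" "Y = R `` {t'}"
      by (auto elim!: quotientE)
    show "g X = g Y \<longleftrightarrow> X = Y"
    proof
      assume "g X = g Y"
      then have "(b t, b t') \<in> r"
        using g t XY refl[OF b[OF t(2)]] by blast
      have "(t, u) \<in> R \<longleftrightarrow> (t', u) \<in> R" for u
      proof (cases "u \<in> T")
        case True
        then show ?thesis
          using iff[OF t(1) True] iff[OF t(2) True] \<open>(b t, b t') \<in> r\<close> sym trans by blast
      next
        case False
        then show ?thesis
          using R by blast
      qed
      then show "X = Y"
        unfolding XY by blast
    qed simp
  next
    fix X assume "X \<in> T // R"
    then obtain t where "t \<in> T" "X = R `` {t}"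
      by (auto elim!: quotientE)
    then show "g X \<in> S // r"
      using g b by (simp add: quotientI)
  next
    fix Y assume "Y \<in> S // r"
    then obtain s where s: "s \<in> S" "Y = r `` {s}"
      by (auto elim!: quotientE)
    obtain t where t: "t \<in> T" "(b t, s) \<in> r"
      using surj[OF s(1)] by blast
    have "Y = g (R `` {t})"
      using g[OF t(1)] t(2) s(2) sym trans by blast
    then show "\<exists>X\<in>T // R. Y = g X"
      using t(1) by (intro bexI[OF _ quotientI])
  qed
  then show ?thesis
    using bij_betw_inv by blast
qed

lemma i_isomorphic_reduced:
  assumes "i_isomorphic br br'" "reduced_quadratic br' cf" "quadratic_lie_algebra br cf"
  shows "reduced_quadratic br cf"
proof -
  obtain \<phi> where \<phi>: "clinear \<phi>" "bij \<phi>" "\<And>x y. \<phi> (br x y) = br' (\<phi> x) (\<phi> y)"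
    "\<And>x y. cf (\<phi> x) (\<phi> y) = cf x y"
    using assms(1) by (auto simp: i_isomorphic_def i_isomorphism_def lie_isomorphism_def)
  have "\<phi> x \<in> lie_center br'" if x: "x \<in> lie_center br" for x
  proof -
    have "br' (\<phi> x) y' = 0" for y'
    proof -
      obtain y where "y' = \<phi> y"
        using \<phi>(2) by (meson bij_pointE)
      then show ?thesis
        using x by (simp add: lie_center_def clinear_simps[OF \<phi>(1)] flip: \<phi>(3))
    qed
    then show ?thesis
      by (simp add: lie_center_def)
  qed
  then have "cf x y = 0" if "x \<in> lie_center br" "y \<in> lie_center br" for x y
    using assms(2) that unfolding reduced_quadratic_def \<phi>(4)[of x y, symmetric] by blast
  then show ?thesis
    using assms(2,3) by (simp add: reduced_quadratic_def)
qed

context paired_coordinates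
begin

lemma std_isomorphism_iff:
  assumes "v \<in> Lambda" "w \<in> Lambda"
  shows "i_isomorphic (std v) (std w) \<longleftrightarrow> (\<exists>h\<in>H_group. w = h v)"
    and "(\<exists>\<phi>. lie_isomorphism (std v) (std w) \<phi>) \<longleftrightarrow> (\<exists>h\<in>H_group. w = h v)"
proof -
  have lie: "\<exists>\<phi>. lie_isomorphism br br' \<phi>" if "i_isomorphic br br'"
    for br br' :: "complex ^ 'm \<Rightarrow> complex ^ 'm \<Rightarrow> complex ^ 'm"
    using that by (auto simp: i_isomorphic_def i_isomorphism_def)
  have orbit: "\<exists>h\<in>H_group. w = h v" if iso: "\<exists>\<phi>. lie_isomorphism (std v) (std w) \<phi>"
  proof -
    obtain \<phi> where \<phi>: "lie_isomorphism (std w) (std v) \<phi>"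
      using iso lie_isomorphism_inv by blast
    obtain \<pi> s c where "bij \<pi>" "\<forall>i. s i = 1 \<or> s i = (- 1 :: complex)" "c \<noteq> 0"
      and w: "w = (\<chi> i. s i * (c * v $ \<pi> i))"
      using lie_isomorphic_std_signed_permutation[OF \<phi> assms(2)] by blast
    then show ?thesis
      unfolding w by (intro H_group_signed_permutation) auto
  qed
  have iso: "i_isomorphic (std v) (std w)" if "\<exists>h\<in>H_group. w = h v"
    using that H_group_i_isomorphic by blast
  show "i_isomorphic (std v) (std w) \<longleftrightarrow> (\<exists>h\<in>H_group. w = h v)"
    using lie orbit iso by blast
  show "(\<exists>\<phi>. lie_isomorphism (std v) (std w) \<phi>) \<longleftrightarrow> (\<exists>h\<in>H_group. w = h v)"
    using lie orbit iso by blast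
qed

lemma diag_i_classes_bij:
  "\<exists>f. bij_betw f (diag_i_classes :: (complex ^ 'm \<Rightarrow> complex ^ 'm \<Rightarrow> complex ^ 'm) set set)
    (H_orbits (Lambda :: (complex ^ 'p) set))"
proof -
  let ?D = "diag_structures :: (complex ^ 'm \<Rightarrow> complex ^ 'm \<Rightarrow> complex ^ 'm) set"
  let ?r = "{(br, br'). br \<in> ?D \<and> br' \<in> ?D \<and> i_isomorphic br br'}"
  have "equiv ?D ?r"
    by (rule equivI)
      (auto simp: refl_on_def sym_def trans_def i_isomorphic_refl intro: i_isomorphic_sym i_isomorphic_trans)
  then show ?thesis
    unfolding diag_i_classes_def H_orbits_def i_isomorphic_def[symmetric]
    by (rule quotient_bij_betw[where b = std])
      (auto simp: std_in_diag_structures std_isomorphism_iff dest: diag_structure_i_isomorphic_std)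
qed

text \<open>
Being reduced is invariant under i-isomorphism, so the standard model is reduced as well.
\<close>

lemma red_diag_structure_i_isomorphic_std:
  assumes "br \<in> red_diag_structures"
  shows "range \<sigma> = UNIV" "\<exists>v\<in>Lambda_plus. i_isomorphic (std v) br"
proof -
  obtain v where v: "v \<in> Lambda" "i_isomorphic (std v) br"
    using assms diag_structure_i_isomorphic_std by (auto simp: red_diag_structures_def)
  have "reduced_quadratic (std v) cf"
    using i_isomorphic_reduced[OF v(2) _ std_quadratic] assms by (simp add: red_diag_structures_def)
  then show "range \<sigma> = UNIV" "\<exists>v\<in>Lambda_plus. i_isomorphic (std v) br"
    using std_reduced_imp v(2) by blast+
qed

lemma red_diag_classes_bij:
  assumes full: "range \<sigma> = UNIV"
  shows "\<exists>f. bij_betw f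
    (red_diag_classes :: (complex ^ 'm \<Rightarrow> complex ^ 'm \<Rightarrow> complex ^ 'm) set set)
    (H_orbits (Lambda_plus :: (complex ^ 'p) set))"
proof -
  let ?D = "red_diag_structures :: (complex ^ 'm \<Rightarrow> complex ^ 'm \<Rightarrow> complex ^ 'm) set"
  let ?r = "{(br, br'). br \<in> ?D \<and> br' \<in> ?D \<and> (\<exists>\<phi>. lie_isomorphism br br' \<phi>)}"
  have equiv: "equiv ?D ?r"
  proof (rule equivI)
    show "refl_on ?D ?r"
      using lie_isomorphism_refl by (auto simp: refl_on_def)
    show "sym ?r"
      using lie_isomorphism_inv unfolding sym_def by blast
    show "trans ?r"
      using lie_isomorphism_comp unfolding trans_def by blast
  qed auto
  have sub: "v \<in> Lambda" if "v \<in> Lambda_plus" for v :: "complex ^ 'p"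
    using that by (simp add: Lambda_def Lambda_plus_def)
  have std_red: "std v \<in> ?D" if "v \<in> Lambda_plus" for v
    using std_in_diag_structures[OF sub] std_reduced[OF full] that
    by (simp add: red_diag_structures_def)
  show ?thesis
    unfolding red_diag_classes_def H_orbits_def
  proof (rule quotient_bij_betw[OF equiv, where b = std])
    fix br assume br: "br \<in> ?D"
    then obtain v where v: "v \<in> Lambda_plus" "i_isomorphic (std v) br"
      using red_diag_structure_i_isomorphic_std by blast
    then have "(std v, br) \<in> ?r"
      using br std_red by (auto simp: i_isomorphic_def i_isomorphism_def)
    then show "\<exists>v\<in>Lambda_plus. (std v, br) \<in> ?r"
      using v(1) by blast
  qed (auto simp: std_red std_isomorphism_iff(2)[OF sub sub])
qed

end

theorem corollary6p8:
  fixes n p :: nat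
  assumes "n \<ge> 2"
    and "n = 2 * p \<or> n = 2 * p + 1"
    and "CARD('m::finite) = n + 2"
    and "CARD('p::finite) = p"
  shows "(\<exists>f. bij_betw f
             (diag_i_classes :: (complex ^ 'm \<Rightarrow> complex ^ 'm \<Rightarrow> complex ^ 'm) set set)
             (H_orbits (Lambda :: (complex ^ 'p) set))) \<and>
         (n = 2 * p + 1 \<longrightarrow>
            (red_diag_classes :: (complex ^ 'm \<Rightarrow> complex ^ 'm \<Rightarrow> complex ^ 'm) set set) = {}) \<and>
         (n = 2 * p \<longrightarrow>
            (\<exists>f. bij_betw f
               (red_diag_classes :: (complex ^ 'm \<Rightarrow> complex ^ 'm \<Rightarrow> complex ^ 'm) set set)
               (H_orbits (Lambda_plus :: (complex ^ 'p) set))))"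
proof -
  have card: "CARD('p option \<times> bool) = 2 * p + 2"
    using assms(4) by (simp add: card_UNIV_option)
  then have "CARD('p option \<times> bool) \<le> CARD('m)"
    using assms by auto
  then obtain \<sigma> :: "'p option \<times> bool \<Rightarrow> 'm" where \<sigma>: "inj \<sigma>"
    using card_le_inj[of "UNIV :: ('p option \<times> bool) set" "UNIV :: 'm set"] by auto
  interpret paired_coordinates \<sigma>
    by unfold_locales (use \<sigma> assms in auto)
  have card_range: "card (range \<sigma>) = 2 * p + 2"
    using card_image[OF \<sigma>] card by simp
  show ?thesis
  proof (intro conjI impI)
    show "\<exists>f. bij_betw f
        (diag_i_classes :: (complex ^ 'm \<Rightarrow> complex ^ 'm \<Rightarrow> complex ^ 'm) set set)
        (H_orbits (Lambda :: (complex ^ 'p) set))"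
      by (rule diag_i_classes_bij)
  next
    assume "n = 2 * p + 1"
    then have "range \<sigma> \<noteq> UNIV"
      using card_range assms(3) by auto
    then have "(red_diag_structures :: (complex ^ 'm \<Rightarrow> complex ^ 'm \<Rightarrow> complex ^ 'm) set) = {}"
      using red_diag_structure_i_isomorphic_std(1) by blast
    then show "(red_diag_classes :: (complex ^ 'm \<Rightarrow> complex ^ 'm \<Rightarrow> complex ^ 'm) set set) = {}"
      by (simp add: red_diag_classes_def)
  next
    assume "n = 2 * p"
    then have "range \<sigma> = UNIV"
      using card_range assms(3) by (intro card_subset_eq) auto
    then show "\<exists>f. bij_betw f
        (red_diag_classes :: (complex ^ 'm \<Rightarrow> complex ^ 'm \<Rightarrow> complex ^ 'm) set set)
        (H_orbits (Lambda_plus :: (complex ^ 'p) set))"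
      by (rule red_diag_classes_bij)
  qed
qed

end
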